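(* Let $\lambda_t>0$ and $\lambda_o>0$ be the densities (per unit area) of transmitters and obstacles, let $\rho_a\in(0,1]$ be the probability that a transmitter is active in a slot, let $d_{\max}>0$ be the interference range, let $\theta\in(0,2\pi]$ be the operating beamwidth and $\theta_c>0$ the coherence angle, with $\theta/\theta_c$ a positive integer. Put $\lambda_I=\rho_a\lambda_t\theta/(2\pi)$ and $A_x=\theta_c x^2/2$ for $x\ge 0$. In the slotted ALOHA model described in the context, the average per-link throughput (in packets per slot) equals $$r_{\text{S-ALOHA}}=\int_0^{d_{\max}}\rho_a\,e^{-\lambda_o A_\ell}\,(1-\rho_{c\mid\ell})\,\frac{2\ell}{d_{\max}^2}\,d\ell ,$$ where $$\rho_{c\mid\ell}=1-\left(\frac{\lambda_o+\lambda_I e^{-(\lambda_o+\lambda_I)A_{d_{\max}}}}{\lambda_o+\lambda_I}\right)^{\lceil\theta/\theta_c\rceil-1}\left(e^{-\lambda_I A_\ell}-\frac{\lambda_I e^{\lambda_o A_\ell}}{\lambda_o+\lambda_I}\left(e^{-(\lambda_o+\lambda_I)A_\ell}-e^{-(\lambda_o+\lambda_I)A_{d_{\max}}}\right)\right).$$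
   Context: Model. A typical receiver is at the origin of the plane, and its main lobe is a circular sector of angle $\theta$ with apex at the origin. This sector is divided into $k=\lceil\theta/\theta_c\rceil$ sectors $S_1,\dots,S_k$ with apex at the origin, each of angle $\theta_c$ (the ratio $\theta/\theta_c$ is assumed to be an integer). Transmitters form a homogeneous Poisson point process of density $\lambda_t$. Each transmitter is independently active with probability $\rho_a$, and independently has the typical receiver inside its main lobe with probability $\theta/(2\pi)$. Hence the potential interferers (active transmitters whose main lobe contains the receiver) form a homogeneous Poisson point process of density $\lambda_I=\rho_a\lambda_t\theta/(2\pi)$. Obstacles (identified with their centers) form a homogeneous Poisson point process of density $\lambda_o$, independent of the transmitters. Typical link. The typical (intended) transmitter is located, without loss of generality, in sector $S_k$, at distance $L$ from the origin, where $L$ has probability density $f_L(\ell)=2\ell/d_{\max}^2$ on $(0,d_{\max}]$. The typical transmitter is not counted as an interferer; it is active with probability $\rho_a$, independently of everything else. The typical link of length $\ell$ is unblocked (established) if there is no obstacle in $S_k$ within distance $\ell$ of the origin. Blockage. Within each sector, an obstacle at distance $l$ from the origin blocks every interferer of that same sector at distance $\ge l$; obstacles have no effect on other sectors. Thus an interferer in sector $S_i$ at distance $d$ from the origin is in line-of-sight (LoS) condition if and only if $S_i$ contains no obstacle at distance $\le d$. Collision. Given $L=\ell$ and that the typical link is established, a collision occurs if at least one of the sectors $S_1,\dots,S_k$ contains a potential interferer at distance at most $d_{\max}$ from the origin that is in LoS condition; $\rho_{c\mid\ell}$ is the conditional probability of collision given that the typical link at length $\ell$ is established. Here $d_{\max}$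 is treated as a fixed parameter. Throughput. One packet is transmitted per slot by an active transmitter. A slot is successful for the typical link if its transmitter is active, the link is unblocked, and no collision occurs. The average per-link throughput $r_{\text{S-ALOHA}}$ is the probability of a successful slot, averaged over $L$. *)

theory Defs
  imports "HOL-Probability.Probability"
begin

section \<open>Homogeneous Poisson point processes in the plane\<close>

text \<open>
  The plane is the type \<^typ>\<open>complex\<close>.  A point process is given by a measurable enumeration
  \<open>X 0, X 1, \<dots>\<close> of its points.  A homogeneous Poisson process of positive intensity on the whole
  plane has almost surely infinitely many points, so that indexing by all of \<^typ>\<open>nat\<close> loses
  nothing; the index serves to attach independent marks to the points.
\<close>

definition point_count :: "(nat \<Rightarrow> 'w \<Rightarrow> complex) \<Rightarrow> complex set \<Rightarrow> 'w \<Rightarrow> nat" where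
  "point_count X B \<omega> = card {n. X n \<omega> \<in> B}"

definition poisson_point_process :: "'w measure \<Rightarrow> real \<Rightarrow> (nat \<Rightarrow> 'w \<Rightarrow> complex) \<Rightarrow> bool" where
  "poisson_point_process M c X \<longleftrightarrow>
     (\<forall>n. X n \<in> borel_measurable M) \<and>
     (\<forall>r. AE \<omega> in M. finite {n. cmod (X n \<omega>) \<le> r}) \<and>
     (\<forall>B j. B \<in> sets borel \<longrightarrow> bounded B \<longrightarrow>
        measure M {\<omega> \<in> space M. point_count X B \<omega> = j} =
          (c * measure lborel B) ^ j / fact j * exp (- (c * measure lborel B))) \<and>
     (\<forall>(B :: nat \<Rightarrow> complex set) m.
        (\<forall>i<m. B i \<in> sets borel \<and> bounded (B i)) \<longrightarrow> disjoint_family_on B {..<m} \<longrightarrow>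
        prob_space.indep_vars M (\<lambda>_. count_space UNIV) (\<lambda>i. point_count X (B i)) {..<m})"

section \<open>Sectors, blockage and collisions\<close>

text \<open>
  Sectors are half-open in the angle and do not contain their apex, so that the subsectors of the
  main lobe are pairwise disjoint.  Boundaries are Lebesgue null sets.
\<close>

definition sector :: "real \<Rightarrow> real \<Rightarrow> complex set" where
  "sector \<alpha> \<beta> = {complex_of_real r * cis t | r t. 0 < r \<and> \<alpha> \<le> t \<and> t < \<alpha> + \<beta>}"

definition num_sectors :: "real \<Rightarrow> real \<Rightarrow> nat" where
  "num_sectors \<theta> \<theta>\<^sub>c = nat \<lceil>\<theta> / \<theta>\<^sub>c\<rceil>"

text \<open>The main lobe is \<open>sector \<alpha> \<theta>\<close>, with arbitrary orientation \<open>\<alpha>\<close>; its subsectors have indices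
  \<open>1, \<dots>, num_sectors \<theta> \<theta>\<^sub>c\<close>.\<close>

definition subsector :: "real \<Rightarrow> real \<Rightarrow> nat \<Rightarrow> complex set" where
  "subsector \<alpha> \<theta>\<^sub>c i = sector (\<alpha> + (real i - 1) * \<theta>\<^sub>c) \<theta>\<^sub>c"

definition clear_upto :: "complex set \<Rightarrow> complex set \<Rightarrow> real \<Rightarrow> bool" where
  "clear_upto S Obs d \<longleftrightarrow> \<not> (\<exists>y\<in>Obs. y \<in> S \<and> cmod y \<le> d)"

text \<open>Some subsector contains an interferer within distance \<open>d_max\<close> in line-of-sight condition.\<close>

definition collides ::
  "real \<Rightarrow> real \<Rightarrow> real \<Rightarrow> real \<Rightarrow> complex set \<Rightarrow> complex set \<Rightarrow> bool" where
  "collides \<alpha> \<theta> \<theta>\<^sub>c d_max Intf Obs \<longleftrightarrow>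
     (\<exists>i\<in>{1..num_sectors \<theta> \<theta>\<^sub>c}. \<exists>x\<in>Intf. x \<in> subsector \<alpha> \<theta>\<^sub>c i \<and> cmod x \<le> d_max \<and>
        clear_upto (subsector \<alpha> \<theta>\<^sub>c i) Obs (cmod x))"

section \<open>The slotted ALOHA model\<close>

definition points :: "(nat \<Rightarrow> 'w \<Rightarrow> complex) \<Rightarrow> 'w \<Rightarrow> complex set" where
  "points X \<omega> = {X n \<omega> | n. True}"

text \<open>\<open>T\<close>: positions of the (non-typical) transmitters; \<open>act n\<close>: transmitter \<open>n\<close> is active;
  \<open>aim n\<close>: the typical receiver is inside the main lobe of transmitter \<open>n\<close>.\<close>

definition interferers ::
  "(nat \<Rightarrow> 'w \<Rightarrow> complex) \<Rightarrow> (nat \<Rightarrow> 'w \<Rightarrow> bool) \<Rightarrow> (nat \<Rightarrow> 'w \<Rightarrow> bool) \<Rightarrow> 'w \<Rightarrow> complex set" where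
  "interferers T act aim \<omega> = {T n \<omega> | n. act n \<omega> \<and> aim n \<omega>}"

datatype source =
    Transmitter_Positions
  | Obstacle_Positions
  | Activity nat
  | Aim nat
  | Link_Length
  | Link_Activity

text \<open>
  \<open>Ob\<close>: positions of the obstacles; \<open>Y\<close>: position of the typical transmitter, whose link length is
  \<open>cmod (Y \<omega>)\<close>; \<open>act\<^sub>0\<close>: the typical transmitter is active.  The last assumption is the mutual
  independence of all sources of randomness, stated for the sigma-algebras they generate because
  they take values in different types.
\<close>

locale slotted_aloha = prob_space M
  for M :: "'w measure" +
  fixes lam\<^sub>t lam\<^sub>o \<rho>\<^sub>a \<theta> \<theta>\<^sub>c \<alpha> d_max :: real
    and T :: "nat \<Rightarrow> 'w \<Rightarrow> complex"
    and act aim :: "nat \<Rightarrow> 'w \<Rightarrow> bool"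
    and Ob :: "nat \<Rightarrow> 'w \<Rightarrow> complex"
    and Y :: "'w \<Rightarrow> complex"
    and act\<^sub>0 :: "'w \<Rightarrow> bool"
  assumes transmitters: "poisson_point_process M lam\<^sub>t T"
    and obstacles: "poisson_point_process M lam\<^sub>o Ob"
    and active: "\<And>n. act n \<in> measurable M (count_space UNIV)"
      "\<And>n. prob {\<omega> \<in> space M. act n \<omega>} = \<rho>\<^sub>a"
    and aimed: "\<And>n. aim n \<in> measurable M (count_space UNIV)"
      "\<And>n. prob {\<omega> \<in> space M. aim n \<omega>} = \<theta> / (2 * pi)"
    and link_active: "act\<^sub>0 \<in> measurable M (count_space UNIV)"
      "prob {\<omega> \<in> space M. act\<^sub>0 \<omega>} = \<rho>\<^sub>a"
    and link_position: "Y \<in> borel_measurable M"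
      "AE \<omega> in M. Y \<omega> \<in> subsector \<alpha> \<theta>\<^sub>c (num_sectors \<theta> \<theta>\<^sub>c)"
    and link_length: "distributed M lborel (\<lambda>\<omega>. cmod (Y \<omega>))
      (\<lambda>l. ennreal (if 0 < l \<and> l \<le> d_max then 2 * l / d_max\<^sup>2 else 0))"
    and independence: "indep_sets (\<lambda>s. case s of
         Transmitter_Positions \<Rightarrow>
           sets (vimage_algebra (space M) (\<lambda>\<omega> n. T n \<omega>) (Pi\<^sub>M UNIV (\<lambda>_. borel)))
       | Obstacle_Positions \<Rightarrow>
           sets (vimage_algebra (space M) (\<lambda>\<omega> n. Ob n \<omega>) (Pi\<^sub>M UNIV (\<lambda>_. borel)))
       | Activity n \<Rightarrow> sets (vimage_algebra (space M) (act n) (count_space UNIV))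
       | Aim n \<Rightarrow> sets (vimage_algebra (space M) (aim n) (count_space UNIV))
       | Link_Length \<Rightarrow> sets (vimage_algebra (space M) (\<lambda>\<omega>. cmod (Y \<omega>)) borel)
       | Link_Activity \<Rightarrow> sets (vimage_algebra (space M) act\<^sub>0 (count_space UNIV))) UNIV"
begin

definition collision :: "'w \<Rightarrow> bool" where
  "collision \<omega> \<longleftrightarrow> collides \<alpha> \<theta> \<theta>\<^sub>c d_max (interferers T act aim \<omega>) (points Ob \<omega>)"

definition established :: "real \<Rightarrow> 'w \<Rightarrow> bool" where
  "established l \<omega> \<longleftrightarrow> clear_upto (subsector \<alpha> \<theta>\<^sub>c (num_sectors \<theta> \<theta>\<^sub>c)) (points Ob \<omega>) l"

text \<open>Neither event depends on the random link length, which is independent of the obstacles and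
  interferers; conditioning on the null event that it equals \<open>l\<close> is therefore left out.\<close>

definition collision_prob :: "real \<Rightarrow> real" where
  "collision_prob l = cond_prob M collision (established l)"

definition successful :: "'w \<Rightarrow> bool" where
  "successful \<omega> \<longleftrightarrow> act\<^sub>0 \<omega> \<and> established (cmod (Y \<omega>)) \<omega> \<and> \<not> collision \<omega>"

definition throughput :: real where
  "throughput = prob {\<omega> \<in> space M. successful \<omega>}"

end

end

theory Submission
  imports Defs
begin

text \<open>
  In a sector of angle \<open>\<theta>\<^sub>c\<close>, measure the distance of a point \<open>x\<close> to the apex by the area
  \<open>\<theta>\<^sub>c |x|\<^sup>2 / 2\<close> of the part of the sector that is at least as close. The void probabilities of a Poisson
  process say exactly that the areas up to the nearest point, in disjoint sectors, are independent
  exponential variables. Independent thinning multiplies the density by the retention probability, so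
  both the obstacles and the potential interferers are of this kind. In sector \<open>i\<close> let \<open>V\<^sub>i\<close> be the area up
  to the nearest obstacle and \<open>U\<^sub>i\<close> the area up to the nearest interferer. Up to null events, a collision
  means \<open>U\<^sub>i \<le> A d_max\<close> and \<open>U\<^sub>i < V\<^sub>i\<close> for some \<open>i\<close>, and a link of length \<open>l\<close> is established iff
  \<open>V\<^sub>k > A l\<close>; so everything reduces to a race between two exponential variables in each sector.
\<close>

section \<open>Areas of circular sectors\<close>

text \<open>A link of length \<open>l\<close> puts the threshold \<open>t = A l\<close> on the
  obstacle variable of sector \<open>k\<close> only; elsewhere the threshold is \<open>0\<close>.
  Integrated over the value of \<open>U\<close>, the event \<open>t < V\<close>,
  \<open>U \<le> \<delta>\<close>, \<open>U < V\<close> splits at \<open>U = t\<close>: below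
  \<open>t\<close> the obstacle condition is \<open>t < V\<close>, above it is \<open>U < V\<close>.
  The second piece integrates \<open>\<mu> * exp (- (\<mu> + \<nu>) * x)\<close>, whence the weight
  \<open>\<mu> / (\<mu> + \<nu>)\<close>. The value at \<open>t = 0\<close> is the base of the power
  with exponent \<open>k - 1\<close>; the factor \<open>exp (lam\<^sub>o * A l)\<close> comes from
  dividing by the probability that the link is established. The obstacle is that the thresholds are
  themselves random: an interferer is tested against obstacles at its own distance, and the link
  length is random. Hence the almost sure descriptions of nearest points hold for all thresholds off
  one null event. Independence is reduced to measurability with respect to disjoint families of
  sources, and the link length is integrated out against its density.\<close>

lemma sector_borel: "sector \<alpha> \<beta> \<in> sets borel"
proof -
  \<comment> \<open>The half-open sector is exhausted by images of closed polar rectangles, whose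
    angles stop \<open>1 / real (Suc n)\<close> short of the open end. Each image is compact, hence
    Borel.\<close>
  define K where "K n = (\<lambda>(r, t). complex_of_real r * cis t) `
      ({1 / real (Suc n)..real n} \<times> {\<alpha>..\<alpha> + \<beta> - 1 / real (Suc n)})" for n
  have "compact (K n)" for n
    unfolding K_def case_prod_unfold
    by (intro compact_continuous_image compact_Times compact_Icc continuous_intros)
  then have "K n \<in> sets borel" for n
    by (rule borel_compact)
  moreover have "sector \<alpha> \<beta> = (\<Union>n. K n)"
  proof (intro equalityI subsetI)
    fix z assume "z \<in> sector \<alpha> \<beta>"
    then obtain r t where z: "z = complex_of_real r * cis t" "0 < r" "\<alpha> \<le> t" "t < \<alpha> + \<beta>"
      unfolding sector_def by blast
    have "\<forall>\<^sub>F n in sequentially. 1 / real (Suc n) < min r (\<alpha> + \<beta> - t)"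
      using z by (intro order_tendstoD(2)[OF LIMSEQ_Suc[OF lim_1_over_n]]) auto
    moreover have "\<forall>\<^sub>F n in sequentially. r \<le> real n"
      using eventually_ge_at_top[of "nat \<lceil>r\<rceil>"] by eventually_elim linarith
    ultimately obtain n where "1 / real (Suc n) < min r (\<alpha> + \<beta> - t)" "r \<le> real n"
      using eventually_happens'[OF sequentially_bot eventually_conj] by blast
    then have "(r, t) \<in> {1 / real (Suc n)..real n} \<times> {\<alpha>..\<alpha> + \<beta> - 1 / real (Suc n)}"
      using z by auto
    then have "z \<in> K n"
      unfolding K_def using z(1) by (intro image_eqI[where x = "(r, t)"]) auto
    then show "z \<in> (\<Union>n. K n)" by blast
  next
    fix z assume "z \<in> (\<Union>n. K n)"
    then obtain n r t where "z = complex_of_real r * cis t"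
      "1 / real (Suc n) \<le> r" "\<alpha> \<le> t" "t \<le> \<alpha> + \<beta> - 1 / real (Suc n)"
      unfolding K_def by auto
    moreover have "0 < 1 / real (Suc n)" by simp
    ultimately show "z \<in> sector \<alpha> \<beta>"
      unfolding sector_def by (smt (verit) mem_Collect_eq)
  qed
  ultimately show ?thesis by auto
qed

lemma zero_notin_sector: "0 \<notin> sector \<alpha> \<beta>"
  by (auto simp: sector_def)

text \<open>The angles of a common point would differ by a multiple of \<open>2 * pi\<close>, while
  the two bounds confine the difference strictly between \<open>0\<close> and
  \<open>2 * pi\<close>.\<close>

lemma sector_disjoint:
  assumes "\<alpha> + \<beta> \<le> \<alpha>'" "\<alpha>' + \<beta>' \<le> \<alpha> + 2 * pi"
  shows "sector \<alpha> \<beta> \<inter> sector \<alpha>' \<beta>' = {}"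
proof (rule ccontr)
  assume "sector \<alpha> \<beta> \<inter> sector \<alpha>' \<beta>' \<noteq> {}"
  then obtain r t r' t' where *: "complex_of_real r * cis t = complex_of_real r' * cis t'"
    "0 < r" "0 < r'" "\<alpha> \<le> t" "t < \<alpha> + \<beta>" "\<alpha>' \<le> t'" "t' < \<alpha>' + \<beta>'"
    unfolding sector_def by blast
  have "cmod (complex_of_real r * cis t) = cmod (complex_of_real r' * cis t')"
    using *(1) by simp
  then have "r = r'" unfolding norm_mult norm_cis using * by simp
  then have "cis t' = cis t" using * by auto
  then have "cis (t' - t) = 1"
    by (simp add: cis_divide[symmetric])
  then have "cos (t' - t) = 1"
    by (metis cis.simps(1) one_complex.simps(1))
  then obtain n :: int where n: "t' - t = n * (2 * pi)"
    unfolding cos_one_2pi_int by auto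
  have "0 < t' - t" "t' - t < 2 * pi" using * assms by linarith+
  then have "0 < real_of_int n" "real_of_int n < 1"
    unfolding n using pi_gt_zero by (auto simp: zero_less_mult_iff)
  then have "0 < n" "n < 1" by simp_all
  then show False by simp
qed

lemma sector_Un:
  assumes "0 \<le> a" "0 \<le> b"
  shows "sector \<alpha> (a + b) = sector \<alpha> a \<union> sector (\<alpha> + a) b"
  using assms unfolding sector_def
  by (auto; smt (verit))

lemma sector_2pi: "sector 0 (2 * pi) = - {0}"
proof (intro equalityI subsetI)
  fix z :: complex assume "z \<in> - {0}"
  then have "z = complex_of_real (cmod z) * cis (Arg2pi z)"
    using Arg2pi_eq[of z] by (simp add: cis_conv_exp)
  then show "z \<in> sector 0 (2 * pi)"
    unfolding sector_def using \<open>z \<in> - {0}\<close> Arg2pi_ge_0[of z] Arg2pi_lt_2pi[of z]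
    by (intro CollectI exI[of _ "cmod z"] exI[of _ "Arg2pi z"]) auto
qed (auto simp: sector_def)

lemma sector_rotate: "sector \<alpha> \<beta> = (*) (cis \<alpha>) ` sector 0 \<beta>"
proof (intro equalityI subsetI)
  fix z assume "z \<in> sector \<alpha> \<beta>"
  then obtain r t where z: "z = complex_of_real r * cis t" "0 < r" "\<alpha> \<le> t" "t < \<alpha> + \<beta>"
    unfolding sector_def by blast
  have "z = cis \<alpha> * (complex_of_real r * cis (t - \<alpha>))"
    using z(1) by (simp add: cis_mult algebra_simps)
  moreover have "complex_of_real r * cis (t - \<alpha>) \<in> sector 0 \<beta>"
    unfolding sector_def using z by (intro CollectI exI[of _ r] exI[of _ "t - \<alpha>"]) auto
  ultimately show "z \<in> (*) (cis \<alpha>) ` sector 0 \<beta>" by blast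
next
  fix z assume "z \<in> (*) (cis \<alpha>) ` sector 0 \<beta>"
  then obtain r t where z: "z = cis \<alpha> * (complex_of_real r * cis t)" "0 < r" "0 \<le> t" "t < \<beta>"
    unfolding sector_def by auto
  have "z = complex_of_real r * cis (\<alpha> + t)"
    using z(1) by (simp add: cis_mult algebra_simps)
  then show "z \<in> sector \<alpha> \<beta>"
    unfolding sector_def using z by (intro CollectI exI[of _ r] exI[of _ "\<alpha> + t"]) auto
qed

text \<open>Identifying the plane with \<open>real^2\<close> gives access to the invariance of
  Lebesgue measure under orthogonal maps. Open boxes determine the measure, and the preimage of a
  box is a box.\<close>

lemma lborel_complex_eq_distr:
  "(lborel :: complex measure) = distr lborel borel (\<lambda>v :: real^2. Complex (v $ 1) (v $ 2))"
proof (rule lborel_eqI)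
  have [measurable]: "(\<lambda>v :: real^2. Complex (v $ 1) (v $ 2)) \<in> borel_measurable borel"
    by (intro borel_measurable_continuous_onI) (simp add: continuous_intros Complex_eq)
  fix l u :: complex assume le: "\<And>b. b \<in> Basis \<Longrightarrow> l \<bullet> b \<le> u \<bullet> b"
  have "(\<lambda>v :: real^2. Complex (v $ 1) (v $ 2)) -` box l u =
      box (vector [Re l, Im l]) (vector [Re u, Im u])"
    by (auto simp: mem_box_cart box_complex_eq forall_2)
  then show "emeasure (distr lborel borel (\<lambda>v :: real^2. Complex (v $ 1) (v $ 2))) (box l u) =
      ennreal (\<Prod>b\<in>Basis. (u - l) \<bullet> b)"
    using le[of 1] le[of \<i>]
    by (simp add: emeasure_distr emeasure_lborel_box_eq Basis_vec_def Basis_complex_def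
        axis_eq_axis inner_axis UNIV_2 prod.insert_if image_iff)
qed simp

text \<open>Transported to \<open>real^2\<close>, multiplication by \<open>cis t\<close> is linear
  and norm-preserving, hence orthogonal. Boundedness makes the set
  \<open>lmeasurable\<close>.\<close>

lemma measure_lborel_rotate:
  assumes "B \<in> sets borel" "bounded B"
  shows "measure lborel ((*) (cis t) ` B) = measure lborel B"
proof -
  define e where "e = (\<lambda>v :: real^2. Complex (v $ 1) (v $ 2))"
  define e' where "e' = (\<lambda>z. vector [Re z, Im z] :: real^2)"
  have ee': "e (e' z) = z" for z by (simp add: e_def e'_def)
  have e'e: "e' (e v) = v" for v by (simp add: e_def e'_def vec_eq_iff forall_2)
  have e_meas [measurable]: "e \<in> borel_measurable borel"
    unfolding e_def
    by (intro borel_measurable_continuous_onI) (simp add: continuous_intros Complex_eq)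
  have norm_e: "norm (e v) = norm v" for v
    by (simp add: e_def cmod_def norm_vec_def L2_set_def sum_2)
  have transfer: "measure lborel C = measure lebesgue (e -` C)" if "C \<in> sets borel" for C
  proof -
    have "measure lborel C = measure (distr lborel borel e) C"
      using lborel_complex_eq_distr by (simp add: e_def)
    also have "\<dots> = measure lborel (e -` C)"
      using that by (simp add: measure_distr)
    also have "\<dots> = measure lebesgue (e -` C)"
      using measurable_sets_borel[OF e_meas that] by simp
    finally show ?thesis .
  qed
  define f where "f = (\<lambda>v. e' (cis t * e v))"
  have "linear f"
    by (rule linearI; simp add: f_def e_def e'_def vec_eq_iff forall_2 algebra_simps)
  moreover have "norm (f v) = norm v" for v
    by (metis ee' f_def mult_1 norm_cis norm_e norm_mult)
  ultimately have f: "orthogonal_transformation f"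
    by (simp add: orthogonal_transformation)
  have "bounded (e -` B)"
    using assms(2) norm_e unfolding bounded_iff by (metis vimageD)
  moreover have "e -` B \<in> sets lebesgue"
    using measurable_sets_borel[OF e_meas assms(1)] by (simp add: sets_completionI_sets)
  ultimately have lm: "e -` B \<in> lmeasurable"
    by (rule bounded_set_imp_lmeasurable)
  \<comment> \<open>The image is a preimage under the inverse rotation, which yields its Borel
    measurability.\<close>
  have img: "(*) (cis t) ` B = (*) (cis (- t)) -` B"
    by (auto simp: cis_mult mult.assoc[symmetric] intro!: image_eqI[where x = "cis (- t) * x" for x])
  have "(*) (cis t) ` B \<in> sets borel"
    unfolding img using assms(1) by (intro measurable_sets_borel[of _ borel]) simp_all
  then have "measure lborel ((*) (cis t) ` B) = measure lebesgue (e -` ((*) (cis t) ` B))"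
    by (rule transfer)
  also have "e -` ((*) (cis t) ` B) = f ` (e -` B)"
    unfolding f_def
    by (auto simp: ee' image_iff) (metis e'e ee' vimageI)
  also have "measure lebesgue (f ` (e -` B)) = measure lebesgue (e -` B)"
    by (rule measure_orthogonal_image[OF f lm])
  also have "\<dots> = measure lborel B"
    using transfer[OF assms(1)] by simp
  finally show ?thesis .
qed

section \<open>Areas of truncated sectors\<close>

lemma sector_disc_borel [measurable]: "sector \<alpha> \<beta> \<inter> cball 0 r \<in> sets borel"
  using sector_borel by auto

lemma bounded_sector_disc: "bounded (sector \<alpha> \<beta> \<inter> cball 0 r)"
  by (meson bounded_cball bounded_subset inf_le2)

lemma measure_sector_disc_shift:
  "measure lborel (sector \<alpha> \<beta> \<inter> cball 0 r) = measure lborel (sector 0 \<beta> \<inter> cball 0 r)"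
proof -
  have "sector \<alpha> \<beta> \<inter> cball 0 r = (*) (cis \<alpha>) ` (sector 0 \<beta> \<inter> cball 0 r)"
    unfolding sector_rotate[of \<alpha>] by (auto simp: norm_mult)
  then show ?thesis
    using measure_lborel_rotate[OF sector_disc_borel bounded_sector_disc] by simp
qed

lemma measure_sector_disc_add:
  assumes "0 \<le> a" "0 \<le> b" "a + b \<le> 2 * pi"
  shows "measure lborel (sector 0 (a + b) \<inter> cball 0 r) =
    measure lborel (sector 0 a \<inter> cball 0 r) + measure lborel (sector 0 b \<inter> cball 0 r)"
proof -
  have "sector 0 (a + b) \<inter> cball 0 r = (sector 0 a \<inter> cball 0 r) \<union> (sector a b \<inter> cball 0 r)"
    using sector_Un[of a b 0] assms by auto
  moreover have "(sector 0 a \<inter> cball 0 r) \<inter> (sector a b \<inter> cball 0 r) = {}"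
    using sector_disjoint[of 0 a a b] assms by auto
  ultimately have "measure lborel (sector 0 (a + b) \<inter> cball 0 r) =
    measure lborel (sector 0 a \<inter> cball 0 r) + measure lborel (sector a b \<inter> cball 0 r)"
    using emeasure_bounded_finite[OF bounded_sector_disc]
    by (simp add: measure_Union less_top[symmetric])
  then show ?thesis
    using measure_sector_disc_shift[of a b] by simp
qed

text \<open>By rotation invariance the area is additive and monotone in the angle, hence linear.\<close>

lemma measure_sector_disc:
  assumes "0 \<le> r" "0 \<le> \<beta>" "\<beta> \<le> 2 * pi"
  shows "measure lborel (sector \<alpha> \<beta> \<inter> cball 0 r) = \<beta> * r\<^sup>2 / 2"
proof -
  define g where "g b = measure lborel (sector 0 b \<inter> cball 0 r)" for b
  have mono: "g a \<le> g b" if "0 \<le> a" "a \<le> b" "b \<le> 2 * pi" for a b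
    using measure_sector_disc_add[of a "b - a" r] that by (simp add: g_def)
  have mult: "g (real j * a) = real j * g a" if "0 \<le> a" "real j * a \<le> 2 * pi" for a j
    using that(2)
  proof (induction j)
    case 0
    have "sector 0 0 = {}" by (auto simp: sector_def)
    then show ?case by (simp add: g_def)
  next
    case (Suc j)
    then have "g (real j * a + a) = g (real j * a) + g a"
      unfolding g_def using that(1)
      by (intro measure_sector_disc_add) (auto simp: algebra_simps)
    then show ?case using Suc that(1) by (simp add: algebra_simps)
  qed
  have full: "g (2 * pi) = pi * r\<^sup>2"
  proof -
    have "emeasure lborel (cball (0 :: complex) r - {0}) = emeasure lborel (cball (0 :: complex) r)"
      by (rule emeasure_Diff_null_set) auto
    moreover have "sector 0 (2 * pi) \<inter> cball 0 r = cball 0 r - {0}"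
      by (auto simp: sector_2pi)
    ultimately show ?thesis
      using content_cball[OF assms(1), of "0 :: complex"]
      by (simp add: g_def measure_def unit_ball_vol_2)
  qed
  \<comment> \<open>Cut the full turn into \<open>Suc n\<close> slices of angle \<open>a\<close>. If
    \<open>\<beta>\<close> lies between \<open>j\<close> and \<open>j + 1\<close> slices, then
    \<open>g \<beta>\<close> and \<open>\<beta> * r\<^sup>2 / 2\<close> both lie in an interval of
    length \<open>g a\<close>, the area of one slice. The full turn is treated apart because
    \<open>j + 1\<close> slices would then exceed \<open>2 * pi\<close>.\<close>
  have near: "\<bar>g \<beta> - \<beta> * r\<^sup>2 / 2\<bar> \<le> (pi * r\<^sup>2) * (1 / real (Suc n))" for n
  proof (cases "\<beta> = 2 * pi")
    case True
    then show ?thesis using full by simp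
  next
    case False
    define a where "a = 2 * pi / real (Suc n)"
    have "0 < a" by (simp add: a_def)
    have ga: "g a = pi * r\<^sup>2 / real (Suc n)"
    proof -
      have "real (Suc n) * a = 2 * pi" by (simp add: a_def)
      then have "real (Suc n) * g a = pi * r\<^sup>2"
        using mult[of a "Suc n"] full \<open>0 < a\<close> by simp
      then show ?thesis by (simp add: field_simps)
    qed
    define j where "j = nat \<lfloor>\<beta> / a\<rfloor>"
    have "real j \<le> \<beta> / a" "\<beta> / a < real j + 1"
      unfolding j_def using assms(2) \<open>0 < a\<close> by (auto simp: of_nat_nat)
    then have j: "real j * a \<le> \<beta>" "\<beta> < real (Suc j) * a"
      using \<open>0 < a\<close> by (simp_all add: field_simps)
    have "real j * a < real (Suc n) * a"
      using j(1) assms(3) False by (simp add: a_def)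
    then have "j < Suc n" using \<open>0 < a\<close> by (simp del: of_nat_Suc)
    then have "real (Suc j) \<le> real (Suc n)" by simp
    then have "real (Suc j) * a \<le> real (Suc n) * a"
      using \<open>0 < a\<close> by (intro mult_right_mono) auto
    then have Sj: "real (Suc j) * a \<le> 2 * pi" by (simp add: a_def del: of_nat_Suc)
    have lo: "real j * g a \<le> g \<beta>"
      using mono[of "real j * a" \<beta>] mult[of a j] j \<open>0 < a\<close> assms by simp
    have hi: "g \<beta> \<le> real (Suc j) * g a"
      using mono[of \<beta> "real (Suc j) * a"] mult[of a "Suc j"] j \<open>0 < a\<close> assms Sj by simp
    have ga': "g a = a * (r\<^sup>2 / 2)" unfolding ga by (simp add: a_def del: of_nat_Suc)
    have "real j * a * (r\<^sup>2 / 2) \<le> \<beta> * (r\<^sup>2 / 2)" "\<beta> * (r\<^sup>2 / 2) \<le> real (Suc j) * a * (r\<^sup>2 / 2)"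
      using j by (auto intro!: mult_right_mono simp del: of_nat_Suc)
    then have "real j * g a \<le> \<beta> * r\<^sup>2 / 2" "\<beta> * r\<^sup>2 / 2 \<le> real j * g a + g a"
      unfolding ga' by (auto simp: distrib_right mult.assoc)
    moreover have "g \<beta> \<le> real j * g a + g a" using hi by (simp add: distrib_right)
    ultimately have "\<bar>g \<beta> - \<beta> * r\<^sup>2 / 2\<bar> \<le> g a"
      using lo by linarith
    then show ?thesis by (simp add: ga)
  qed
  have "(\<lambda>n. (pi * r\<^sup>2) * (1 / real (Suc n))) \<longlonglongrightarrow> pi * r\<^sup>2 * 0"
    by (intro tendsto_mult tendsto_const LIMSEQ_Suc[OF lim_1_over_n])
  then have "\<bar>g \<beta> - \<beta> * r\<^sup>2 / 2\<bar> \<le> pi * r\<^sup>2 * 0"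
    by (rule LIMSEQ_le_const) (use near in blast)
  then show ?thesis
    using measure_sector_disc_shift[of \<alpha> \<beta> r] by (simp add: g_def)
qed

section \<open>Nearest points, thinning and exponential races\<close>

text \<open>Junk value: \<open>nearest \<kappa> S f = 0\<close> if \<open>f\<close> has no point in \<open>S\<close>.\<close>

definition nearest :: "real \<Rightarrow> complex set \<Rightarrow> (nat \<Rightarrow> complex) \<Rightarrow> real" where
  "nearest \<kappa> S f = enn2real (INF n. if f n \<in> S then ennreal (\<kappa> * (cmod (f n))\<^sup>2) else \<infinity>)"

lemma nearest_measurable [measurable]:
  assumes [measurable]: "S \<in> sets borel"
  shows "nearest \<kappa> S \<in> borel_measurable (\<Pi>\<^sub>M n\<in>UNIV. borel)"
  unfolding nearest_def by measurable

lemma nearest_nonneg: "0 \<le> nearest \<kappa> S f"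
  by (simp add: nearest_def)

text \<open>Local finiteness turns the infimum into a minimum, so that even the non-strict
  inequality is witnessed by a point. The point \<open>f m\<close> in \<open>S\<close> rules out the
  junk value.\<close>

lemma nearest_le_iff:
  assumes "0 \<le> \<kappa>" "f m \<in> S" and fin: "\<And>r. finite {n. f n \<in> S \<and> cmod (f n) \<le> r}"
  shows "nearest \<kappa> S f \<le> a \<longleftrightarrow> (\<exists>n. f n \<in> S \<and> \<kappa> * (cmod (f n))\<^sup>2 \<le> a)"
proof -
  \<comment> \<open>Only the finitely many points at least as close as \<open>f m\<close> compete
    for the minimum.\<close>
  define F where "F = {n. f n \<in> S \<and> cmod (f n) \<le> cmod (f m)}"
  have "finite F" "m \<in> F" using fin assms(2) by (auto simp: F_def)
  then obtain k where k: "k \<in> F" "\<And>n. n \<in> F \<Longrightarrow> cmod (f k) \<le> cmod (f n)"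
    using ex_min_if_finite[of "(\<lambda>n. cmod (f n)) ` F"] by (auto simp: not_less)
  have kS: "f k \<in> S" using k(1) by (simp add: F_def)
  have "cmod (f k) \<le> cmod (f n)" if "f n \<in> S" for n
    using k that by (cases "n \<in> F") (auto simp: F_def)
  then have min: "\<kappa> * (cmod (f k))\<^sup>2 \<le> \<kappa> * (cmod (f n))\<^sup>2" if "f n \<in> S" for n
    using that assms(1) by (intro mult_left_mono power_mono) auto
  have "(INF n. if f n \<in> S then ennreal (\<kappa> * (cmod (f n))\<^sup>2) else \<infinity>) = ennreal (\<kappa> * (cmod (f k))\<^sup>2)"
  proof (rule antisym)
    show "(INF n. if f n \<in> S then ennreal (\<kappa> * (cmod (f n))\<^sup>2) else \<infinity>) \<le> ennreal (\<kappa> * (cmod (f k))\<^sup>2)"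
      using kS by (intro INF_lower2[of k]) auto
    show "ennreal (\<kappa> * (cmod (f k))\<^sup>2) \<le> (INF n. if f n \<in> S then ennreal (\<kappa> * (cmod (f n))\<^sup>2) else \<infinity>)"
    proof (rule INF_greatest)
      show "ennreal (\<kappa> * (cmod (f k))\<^sup>2) \<le> (if f n \<in> S then ennreal (\<kappa> * (cmod (f n))\<^sup>2) else \<infinity>)" for n
        using min[of n] by (auto intro: ennreal_leI)
    qed
  qed
  then have "nearest \<kappa> S f = \<kappa> * (cmod (f k))\<^sup>2"
    using assms(1) by (simp add: nearest_def)
  then show ?thesis using kS min by (auto intro: order_trans)
qed

context prob_space
begin

text \<open>Split by the exact set \<open>F\<close> of indices of points in \<open>B\<close>. On
  that event \<open>B\<close> is void after thinning iff all marks in \<open>F\<close> fail, which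
  has conditional probability \<open>(1 - p) ^ card F\<close>. Averaging over the Poisson count
  gives \<open>exp (- c * b) * exp ((1 - p) * c * b)\<close> with \<open>b\<close> the area of
  \<open>B\<close>. In the independent family, \<open>None\<close> carries the positions and
  \<open>Some n\<close> the failure of mark \<open>n\<close>.\<close>

lemma thinned_void_probability:
  assumes T: "poisson_point_process M c T"
    and indep: "indep_sets (case_option
        (sets (vimage_algebra (space M) (\<lambda>\<omega> n. T n \<omega>) (\<Pi>\<^sub>M n\<in>UNIV. borel)))
        (\<lambda>n. {{\<omega> \<in> space M. \<not> mark n \<omega>}})) UNIV"
    and q: "\<And>n. prob {\<omega> \<in> space M. \<not> mark n \<omega>} = 1 - p"
    and B: "B \<in> sets borel" "bounded B"
  shows "prob {\<omega> \<in> space M. \<forall>n. mark n \<omega> \<longrightarrow> T n \<omega> \<notin> B} = exp (- (c * p * measure lborel B))"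
proof -
  note [measurable] = B(1)
  have T_meas [measurable]: "T n \<in> borel_measurable M" for n
    using T by (simp add: poisson_point_process_def)
  have sub: "case_option
      (sets (vimage_algebra (space M) (\<lambda>\<omega> n. T n \<omega>) (\<Pi>\<^sub>M n\<in>UNIV. borel)))
      (\<lambda>n. {{\<omega> \<in> space M. \<not> mark n \<omega>}}) i \<subseteq> events" for i
    using indep by (simp add: indep_sets_def)
  have unmarked [measurable]: "{\<omega> \<in> space M. \<not> mark n \<omega>} \<in> events" for n
    using sub[of "Some n"] by simp
  have mark_meas [measurable]: "Measurable.pred M (mark n)" for n
  proof -
    have "{\<omega> \<in> space M. mark n \<omega>} = space M - {\<omega> \<in> space M. \<not> mark n \<omega>}" by auto
    then show ?thesis unfolding pred_def by simp
  qed
  define V where "V = {\<omega> \<in> space M. \<forall>n. mark n \<omega> \<longrightarrow> T n \<omega> \<notin> B}"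
  have V_meas [measurable]: "V \<in> events" unfolding V_def by measurable
  define E where "E F = {\<omega> \<in> space M. {n. T n \<omega> \<in> B} = F}" for F
  have E_source: "E F \<in> sets (vimage_algebra (space M) (\<lambda>\<omega> n. T n \<omega>) (\<Pi>\<^sub>M n\<in>UNIV. borel))" for F
  proof -
    have "E F = (\<lambda>\<omega> n. T n \<omega>) -` {f \<in> space (\<Pi>\<^sub>M n\<in>UNIV. borel). \<forall>n. f n \<in> B \<longleftrightarrow> n \<in> F} \<inter> space M"
      by (auto simp: E_def space_PiM)
    also have "\<dots> \<in> sets (vimage_algebra (space M) (\<lambda>\<omega> n. T n \<omega>) (\<Pi>\<^sub>M n\<in>UNIV. borel))"
      by (intro in_vimage_algebra) measurable
    finally show ?thesis .
  qed
  have E_meas [measurable]: "E F \<in> events" for F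
    using E_source[of F] sub[of None] by auto
  have VE: "prob (V \<inter> E F) = (1 - p) ^ card F * prob (E F)" if F: "finite F" for F
  proof -
    define A where "A = case_option (E F) (\<lambda>n. {\<omega> \<in> space M. \<not> mark n \<omega>})"
    have "prob (\<Inter>j\<in>insert None (Some ` F). A j) = (\<Prod>j\<in>insert None (Some ` F). prob (A j))"
      using F E_source by (intro indep_setsD[OF indep]) (auto simp: A_def)
    moreover have "(\<Inter>j\<in>insert None (Some ` F). A j) = V \<inter> E F"
      by (auto simp: A_def V_def E_def)
    ultimately show ?thesis
      using F by (simp add: A_def prod.reindex q)
  qed
  \<comment> \<open>Finiteness is demanded explicitly because \<open>card\<close> is
    \<open>0\<close> on infinite sets; \<open>N j\<close> then is a disjoint union of events
    \<open>E F\<close> over countably many finite \<open>F\<close>, and agrees almost surely with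
    the count being \<open>j\<close>.\<close>
  define N where "N j = {\<omega> \<in> space M. finite {n. T n \<omega> \<in> B} \<and> card {n. T n \<omega> \<in> B} = j}" for j
  have fin: "AE \<omega> in M. finite {n. T n \<omega> \<in> B}"
  proof -
    obtain r where r: "\<And>x. x \<in> B \<Longrightarrow> cmod x \<le> r"
      using B(2) unfolding bounded_iff by auto
    have "AE \<omega> in M. finite {n. cmod (T n \<omega>) \<le> r}"
      using T by (simp add: poisson_point_process_def)
    then show ?thesis
      by eventually_elim (use r in \<open>auto elim: finite_subset[rotated]\<close>)
  qed
  have N_E: "N j = (\<Union>F\<in>{F. finite F \<and> card F = j}. E F)" for j
    by (auto simp: N_def E_def)
  have cnt: "countable {F :: nat set. finite F \<and> card F = j}" for j
    by (rule countable_subset[OF _ countable_Collect_finite]) auto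
  have N_meas [measurable]: "N j \<in> events" for j
    unfolding N_E using cnt by (intro sets.countable_UN') auto
  have point_count_meas: "Measurable.pred M (\<lambda>\<omega>. point_count T B \<omega> = j)" for j
  proof -
    \<comment> \<open>Measurability of a single count is read off from the independence clause for
      the one-element family consisting of \<open>B\<close>.\<close>
    have "point_count T B \<in> measurable M (count_space UNIV)"
      using T B unfolding poisson_point_process_def
      by (auto simp: indep_vars_def dest!: spec[of "\<lambda>B. \<forall>m. _ B m" "\<lambda>_. B"] spec[of _ "1::nat"]
          simp: disjoint_family_on_def)
    then show ?thesis by measurable
  qed
  have PN: "prob (N j) = (c * measure lborel B) ^ j / fact j * exp (- (c * measure lborel B))" for j
  proof -
    have "prob (N j) = prob {\<omega> \<in> space M. point_count T B \<omega> = j}"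
      using fin point_count_meas
      by (intro finite_measure_eq_AE) (auto simp: N_def point_count_def)
    then show ?thesis using T B by (simp add: poisson_point_process_def)
  qed
  have VN: "prob (V \<inter> N j) = (1 - p) ^ j * prob (N j)" for j
  proof -
    have p1: "0 \<le> 1 - p" using q[of 0] by (metis measure_nonneg)
    have disj: "disjoint_family_on (\<lambda>F. V \<inter> E F) {F. finite F \<and> card F = j}"
      "disjoint_family_on E {F. finite F \<and> card F = j}"
      by (auto simp: disjoint_family_on_def E_def)
    have "emeasure M (V \<inter> N j) = emeasure M (\<Union>F\<in>{F. finite F \<and> card F = j}. V \<inter> E F)"
      by (intro arg_cong[where f = "emeasure M"]) (auto simp: N_E)
    also have "\<dots> = (\<integral>\<^sup>+F. emeasure M (V \<inter> E F) \<partial>count_space {F. finite F \<and> card F = j})"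
      using cnt disj by (intro emeasure_UN_countable) auto
    also have "\<dots> = (\<integral>\<^sup>+F. ennreal ((1 - p) ^ j) * emeasure M (E F) \<partial>count_space {F. finite F \<and> card F = j})"
      using p1 by (intro nn_integral_cong) (auto simp: emeasure_eq_measure VE ennreal_mult')
    also have "\<dots> = ennreal ((1 - p) ^ j) * (\<integral>\<^sup>+F. emeasure M (E F) \<partial>count_space {F. finite F \<and> card F = j})"
      by (rule nn_integral_cmult) simp
    also have "(\<integral>\<^sup>+F. emeasure M (E F) \<partial>count_space {F. finite F \<and> card F = j}) = emeasure M (N j)"
      unfolding N_E using cnt disj by (intro emeasure_UN_countable[symmetric]) auto
    finally show ?thesis
      using p1 by (simp add: emeasure_eq_measure ennreal_mult'[symmetric])
  qed
  have "(\<lambda>j. prob (V \<inter> N j)) sums prob (\<Union>j. V \<inter> N j)"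
    by (intro finite_measure_UNION) (auto simp: disjoint_family_on_def N_def)
  moreover have "prob (\<Union>j. V \<inter> N j) = prob V"
    using fin by (intro finite_measure_eq_AE) (auto simp: N_def V_def)
  moreover have "(\<lambda>j. exp (- (c * measure lborel B)) * (((1 - p) * (c * measure lborel B)) ^ j /\<^sub>R fact j)) sums
      (exp (- (c * measure lborel B)) * exp ((1 - p) * (c * measure lborel B)))"
    by (intro sums_mult exp_converges)
  moreover have "exp (- (c * measure lborel B)) * (((1 - p) * (c * measure lborel B)) ^ j /\<^sub>R fact j) =
      prob (V \<inter> N j)" for j
    by (simp add: VN PN power_mult_distrib divide_inverse)
  ultimately have "prob V = exp (- (c * measure lborel B)) * exp ((1 - p) * (c * measure lborel B))"
    using sums_unique2 by auto
  then show ?thesis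
    by (simp add: V_def exp_add[symmetric] algebra_simps)
qed

text \<open>The joint law is a product, so Fubini replaces conditioning on the null event
  \<open>L = x\<close> by integration against the density. This serves both the race between
  exponentials and the averaging over the link length.\<close>

lemma emeasure_indep_distributed:
  fixes L :: "'a \<Rightarrow> real"
  assumes indep: "indep_var borel L N Z" and L: "distributed M lborel L f"
    and Q: "Measurable.pred (borel \<Otimes>\<^sub>M N) (\<lambda>(x, z). Q x z)"
  shows "emeasure M {\<omega> \<in> space M. Q (L \<omega>) (Z \<omega>)} =
    (\<integral>\<^sup>+x. f x * emeasure M {\<omega> \<in> space M. Q x (Z \<omega>)} \<partial>lborel)"
proof -
  have [measurable]: "L \<in> borel_measurable M" "Z \<in> measurable M N"
    using indep by (blast dest: indep_var_rv1 indep_var_rv2)+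
  have [measurable]: "f \<in> borel_measurable lborel"
    using L by (simp add: distributed_def)
  define A where "A = {w \<in> space (borel \<Otimes>\<^sub>M N). case w of (x, z) \<Rightarrow> Q x z}"
  have A [measurable]: "A \<in> sets (borel \<Otimes>\<^sub>M N)"
    unfolding A_def by (rule predE[OF Q])
  interpret Z: prob_space "distr M N Z" by (rule prob_space_distr) simp
  have A': "A \<in> sets (distr M borel L \<Otimes>\<^sub>M distr M N Z)"
    using A by (simp cong: sets_pair_measure_cong)
  have "emeasure M {\<omega> \<in> space M. Q (L \<omega>) (Z \<omega>)} =
      emeasure (distr M (borel \<Otimes>\<^sub>M N) (\<lambda>\<omega>. (L \<omega>, Z \<omega>))) A"
    using measurable_space[of Z M N]
    by (subst emeasure_distr[OF _ A])
      (auto simp: A_def space_pair_measure intro!: arg_cong[where f = "emeasure M"])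
  also have "\<dots> = emeasure (distr M borel L \<Otimes>\<^sub>M distr M N Z) A"
    using indep by (simp add: indep_var_distribution_eq)
  also have "\<dots> = (\<integral>\<^sup>+x. emeasure (distr M N Z) (Pair x -` A) \<partial>distr M borel L)"
    by (rule Z.emeasure_pair_measure_alt[OF A'])
  also have "distr M borel L = density lborel f"
    using L distr_cong[of M M borel lborel L L] by (simp add: distributed_def)
  also have "(\<integral>\<^sup>+x. emeasure (distr M N Z) (Pair x -` A) \<partial>density lborel f) =
      (\<integral>\<^sup>+x. f x * emeasure (distr M N Z) (Pair x -` A) \<partial>lborel)"
  proof (rule nn_integral_density)
    have "(\<lambda>x. emeasure (distr M N Z) (Pair x -` A)) \<in> borel_measurable (borel :: real measure)"
      by (rule Z.measurable_emeasure_Pair) (use A in \<open>simp cong: sets_pair_measure_cong\<close>)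
    then show "(\<lambda>x. emeasure (distr M N Z) (Pair x -` A)) \<in> borel_measurable lborel" by simp
  qed simp
  also have "\<dots> = (\<integral>\<^sup>+x. f x * emeasure M {\<omega> \<in> space M. Q x (Z \<omega>)} \<partial>lborel)"
  proof (rule nn_integral_cong)
    fix x :: real
    have "emeasure (distr M N Z) (Pair x -` A) = emeasure M {\<omega> \<in> space M. Q x (Z \<omega>)}"
      using measurable_space[of Z M N]
      by (subst emeasure_distr[OF _ sets_Pair1[OF A]])
        (auto simp: A_def space_pair_measure intro!: arg_cong[where f = "emeasure M"])
    then show "f x * emeasure (distr M N Z) (Pair x -` A) = f x * emeasure M {\<omega> \<in> space M. Q x (Z \<omega>)}"
      by simp
  qed
  finally show ?thesis .
qed

text \<open>The complementary event inside \<open>t < V\<close> is computed by integrating over the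
  value \<open>x\<close> of \<open>U\<close>: it must not exceed \<open>\<delta>\<close>, and
  \<open>V\<close> must exceed the larger of \<open>x\<close> and \<open>t\<close>.\<close>

lemma exponential_race:
  assumes indep: "indep_var borel U borel V"
    and U: "distributed M lborel U (exponential_density \<mu>)"
    and V: "distributed M lborel V (exponential_density \<nu>)"
    and pos: "0 < \<mu>" "0 < \<nu>" and t: "0 \<le> t" "t \<le> \<delta>"
  shows "prob {\<omega> \<in> space M. t < V \<omega> \<and> \<not> (U \<omega> \<le> \<delta> \<and> U \<omega> < V \<omega>)} =
    exp (- \<nu> * t) * exp (- \<mu> * t) -
      \<mu> / (\<mu> + \<nu>) * (exp (- (\<mu> + \<nu>) * t) - exp (- (\<mu> + \<nu>) * \<delta>))"
proof -
  have [measurable]: "U \<in> borel_measurable M" "V \<in> borel_measurable M"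
    using indep by (blast dest: indep_var_rv1 indep_var_rv2)+
  have V_gt: "emeasure M {\<omega> \<in> space M. a < V \<omega>} = ennreal (exp (- \<nu> * a))" if "0 \<le> a" for a
    using exponential_distributedD_gt[OF V that pos(2)]
    by (simp add: emeasure_eq_measure mult.commute)
  have antideriv: "((\<lambda>x. - \<mu> / s * exp (- s * x)) has_real_derivative \<mu> * exp (- s * x)) (at x within A)"
    if "0 < s" for s x A
    using that by (auto intro!: derivative_eq_intros)
  define R where "R = {\<omega> \<in> space M. U \<omega> \<le> \<delta> \<and> U \<omega> < V \<omega> \<and> t < V \<omega>}"
  have "emeasure M R =
      (\<integral>\<^sup>+x. ennreal (exponential_density \<mu> x) * emeasure M {\<omega> \<in> space M. x \<le> \<delta> \<and> x < V \<omega> \<and> t < V \<omega>} \<partial>lborel)"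
    unfolding R_def by (rule emeasure_indep_distributed[OF indep U]) measurable
  also have "\<dots> = (\<integral>\<^sup>+x. ennreal (\<mu> * exp (- \<mu> * x) * exp (- \<nu> * t)) * indicator {0..t} x +
      ennreal (\<mu> * exp (- (\<mu> + \<nu>) * x)) * indicator {t..\<delta>} x \<partial>lborel)"
  proof (rule nn_integral_cong_AE)
    \<comment> \<open>At \<open>x = t\<close> both indicators equal \<open>1\<close>, so the
      integrands agree only off this null point.\<close>
    have "AE x in lborel. x \<noteq> t"
      by (rule AE_lborel_singleton)
    then show "AE x in lborel.
      ennreal (exponential_density \<mu> x) * emeasure M {\<omega> \<in> space M. x \<le> \<delta> \<and> x < V \<omega> \<and> t < V \<omega>} =
      ennreal (\<mu> * exp (- \<mu> * x) * exp (- \<nu> * t)) * indicator {0..t} x +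
      ennreal (\<mu> * exp (- (\<mu> + \<nu>) * x)) * indicator {t..\<delta>} x"
    proof eventually_elim
      case (elim x)
      consider "x < 0" | "0 \<le> x" "x < t" | "t < x" "x \<le> \<delta>" | "t < x" "\<delta> < x" using elim by linarith
      then show ?case
      proof cases
        case 1
        then show ?thesis using t by (simp add: exponential_density_def)
      next
        case 2
        then have "{\<omega> \<in> space M. x \<le> \<delta> \<and> x < V \<omega> \<and> t < V \<omega>} = {\<omega> \<in> space M. t < V \<omega>}"
          using t by auto
        then show ?thesis using 2 t pos
          by (simp add: exponential_density_def V_gt ennreal_mult'[symmetric] mult.commute)
      next
        case 3
        then have "{\<omega> \<in> space M. x \<le> \<delta> \<and> x < V \<omega> \<and> t < V \<omega>} = {\<omega> \<in> space M. x < V \<omega>}"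
          by auto
        then show ?thesis using 3 t pos
          by (simp add: exponential_density_def V_gt ennreal_mult'[symmetric] exp_add[symmetric] algebra_simps)
      next
        case 4
        then show ?thesis using t by simp
      qed
    qed
  qed
  also have "\<dots> = (\<integral>\<^sup>+x. ennreal (\<mu> * exp (- \<mu> * x) * exp (- \<nu> * t)) * indicator {0..t} x \<partial>lborel) +
      (\<integral>\<^sup>+x. ennreal (\<mu> * exp (- (\<mu> + \<nu>) * x)) * indicator {t..\<delta>} x \<partial>lborel)"
    by (rule nn_integral_add) auto
  also have "(\<integral>\<^sup>+x. ennreal (\<mu> * exp (- \<mu> * x) * exp (- \<nu> * t)) * indicator {0..t} x \<partial>lborel) =
      ennreal (- exp (- \<mu> * t) * exp (- \<nu> * t) - - exp (- \<mu> * 0) * exp (- \<nu> * t))"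
    using t pos by (intro nn_integral_FTC_Icc) (auto intro!: derivative_eq_intros)
  also have "(\<integral>\<^sup>+x. ennreal (\<mu> * exp (- (\<mu> + \<nu>) * x)) * indicator {t..\<delta>} x \<partial>lborel) =
      ennreal (- \<mu> / (\<mu> + \<nu>) * exp (- (\<mu> + \<nu>) * \<delta>) - - \<mu> / (\<mu> + \<nu>) * exp (- (\<mu> + \<nu>) * t))"
    using t pos antideriv[of "\<mu> + \<nu>"] by (intro nn_integral_FTC_Icc) auto
  also have "ennreal (- exp (- \<mu> * t) * exp (- \<nu> * t) - - exp (- \<mu> * 0) * exp (- \<nu> * t)) +
      ennreal (- \<mu> / (\<mu> + \<nu>) * exp (- (\<mu> + \<nu>) * \<delta>) - - \<mu> / (\<mu> + \<nu>) * exp (- (\<mu> + \<nu>) * t)) =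
      ennreal (exp (- \<nu> * t) - exp (- \<mu> * t) * exp (- \<nu> * t) +
        \<mu> / (\<mu> + \<nu>) * (exp (- (\<mu> + \<nu>) * t) - exp (- (\<mu> + \<nu>) * \<delta>)))" (is "_ = ennreal ?r")
  proof (subst ennreal_plus[symmetric])
    show "0 \<le> - exp (- \<mu> * t) * exp (- \<nu> * t) - - exp (- \<mu> * 0) * exp (- \<nu> * t)"
      using t pos by simp
    have "\<mu> / (\<mu> + \<nu>) * exp (- (\<mu> + \<nu>) * \<delta>) \<le> \<mu> / (\<mu> + \<nu>) * exp (- (\<mu> + \<nu>) * t)"
      using t pos by (intro mult_left_mono) auto
    then show "0 \<le> - \<mu> / (\<mu> + \<nu>) * exp (- (\<mu> + \<nu>) * \<delta>) - - \<mu> / (\<mu> + \<nu>) * exp (- (\<mu> + \<nu>) * t)"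
      by simp
  qed (simp add: algebra_simps)
  finally have R: "emeasure M R = ennreal ?r" .
  have "0 \<le> ?r"
    using t pos by (intro add_nonneg_nonneg mult_nonneg_nonneg) auto
  then have PR: "prob R = ?r"
    using R by (simp add: emeasure_eq_measure)
  have "prob {\<omega> \<in> space M. t < V \<omega> \<and> \<not> (U \<omega> \<le> \<delta> \<and> U \<omega> < V \<omega>)} =
      prob ({\<omega> \<in> space M. t < V \<omega>} - R)"
    by (intro arg_cong[where f = prob]) (auto simp: R_def)
  also have "\<dots> = prob {\<omega> \<in> space M. t < V \<omega>} - prob R"
    by (intro finite_measure_Diff) (auto simp: R_def)
  also have "prob {\<omega> \<in> space M. t < V \<omega>} = exp (- \<nu> * t)"
    using V_gt[OF t(1)] by (simp add: emeasure_eq_measure)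
  finally show ?thesis
    unfolding PR by (simp add: mult.commute)
qed

end

section \<open>Processes with Poisson void probabilities\<close>

text \<open>Void probabilities are all of the Poisson law that is needed: those of unions of truncated sectors
  give the joint survival function of the nearest points. Points at the origin are ignored,
  because \<open>thinned\<close> below moves discarded points there.\<close>

definition void_process :: "'w measure \<Rightarrow> real \<Rightarrow> (nat \<Rightarrow> 'w \<Rightarrow> complex) \<Rightarrow> bool" where
  "void_process M c X \<longleftrightarrow>
     (\<forall>n. X n \<in> borel_measurable M) \<and>
     (\<forall>r. AE \<omega> in M. finite {n. X n \<omega> \<noteq> 0 \<and> cmod (X n \<omega>) \<le> r}) \<and>
     (\<forall>B. B \<in> sets borel \<longrightarrow> bounded B \<longrightarrow> 0 \<notin> B \<longrightarrow>
        measure M {\<omega> \<in> space M. \<forall>n. X n \<omega> \<notin> B} = exp (- (c * measure lborel B)))"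

lemma void_process_measurable: "void_process M c X \<Longrightarrow> X n \<in> borel_measurable M"
  by (simp add: void_process_def)

lemma void_process_prob:
  assumes "void_process M c X" "B \<in> sets borel" "bounded B" "0 \<notin> B"
  shows "measure M {\<omega> \<in> space M. \<forall>n. X n \<omega> \<notin> B} = exp (- (c * measure lborel B))"
  using assms by (simp add: void_process_def)

lemma nearest_process_measurable:
  assumes [measurable]: "\<And>n. X n \<in> borel_measurable M" "S \<in> sets borel"
  shows "(\<lambda>\<omega>. nearest \<kappa> S (\<lambda>n. X n \<omega>)) \<in> borel_measurable M"
  unfolding nearest_def by measurable

context prob_space
begin

lemma indep_var_commute:
  assumes "indep_var S X T Y"
  shows "indep_var T Y S X"
  unfolding indep_var_eq indep_sets2_eq
proof (intro conjI ballI)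
  fix a b
  assume "a \<in> sigma_sets (space M) {Y -` A \<inter> space M |A. A \<in> sets T}"
    "b \<in> sigma_sets (space M) {X -` A \<inter> space M |A. A \<in> sets S}"
  then have "prob (b \<inter> a) = prob b * prob a"
    using assms unfolding indep_var_eq indep_sets2_eq by blast
  then show "prob (a \<inter> b) = prob a * prob b"
    by (simp add: Int_commute mult.commute)
qed (use assms in \<open>unfold indep_var_eq indep_sets2_eq, blast\<close>)+

text \<open>The void probability of the sector cut off at radius \<open>n\<close> is
  \<open>exp (- c * \<beta> * n^2 / 2)\<close>, which tends to \<open>0\<close>. This excludes the
  junk value of \<open>nearest\<close> almost surely.\<close>

lemma void_process_hits_sector:
  assumes X: "void_process M c X" and pos: "0 < c" "0 < \<beta>" "\<beta> \<le> 2 * pi"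
  shows "AE \<omega> in M. \<exists>n. X n \<omega> \<in> sector \<alpha> \<beta>"
proof -
  have [measurable]: "X n \<in> borel_measurable M" for n
    by (rule void_process_measurable[OF X])
  note sector_borel [measurable]
  define E where "E = {\<omega> \<in> space M. \<forall>n. X n \<omega> \<notin> sector \<alpha> \<beta>}"
  have E [measurable]: "E \<in> events" unfolding E_def by measurable
  have le: "prob E \<le> exp (- (c * \<beta> / 2 * (real n)\<^sup>2))" for n
  proof -
    have "prob E \<le> prob {\<omega> \<in> space M. \<forall>m. X m \<omega> \<notin> sector \<alpha> \<beta> \<inter> cball 0 (real n)}"
      by (intro finite_measure_mono) (auto simp: E_def)
    also have "\<dots> = exp (- (c * measure lborel (sector \<alpha> \<beta> \<inter> cball 0 (real n))))"
      using zero_notin_sector by (intro void_process_prob[OF X sector_disc_borel bounded_sector_disc]) auto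
    also have "\<dots> = exp (- (c * \<beta> / 2 * (real n)\<^sup>2))"
      using pos by (simp add: measure_sector_disc)
    finally show ?thesis .
  qed
  have "(\<lambda>n. exp (- (c * \<beta> / 2 * (real n)\<^sup>2))) \<longlonglongrightarrow> 0"
    using pos
    by (intro filterlim_compose[OF exp_at_bot] filterlim_compose[OF filterlim_uminus_at_bot_at_top]
        filterlim_tendsto_pos_mult_at_top[OF tendsto_const] filterlim_pow_at_top
        filterlim_real_sequentially) auto
  then have "prob E \<le> 0"
    by (rule LIMSEQ_le_const) (use le in blast)
  then have "prob E = 0" by (simp add: measure_le_0_iff)
  then show ?thesis
    by (intro AE_I[of _ _ E]) (auto simp: E_def emeasure_eq_measure)
qed

text \<open>The quantifier over \<open>a\<close> stands inside \<open>AE\<close>: one null event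
  serves all thresholds, so that \<open>a\<close> may later depend on
  \<open>\<omega>\<close>.\<close>

lemma nearest_le_iff_AE:
  assumes X: "void_process M c X" and pos: "0 < c" "0 < \<beta>" "\<beta> \<le> 2 * pi" and "0 \<le> \<kappa>"
  shows "AE \<omega> in M. \<forall>a. nearest \<kappa> (sector \<alpha> \<beta>) (\<lambda>n. X n \<omega>) \<le> a \<longleftrightarrow>
    (\<exists>n. X n \<omega> \<in> sector \<alpha> \<beta> \<and> \<kappa> * (cmod (X n \<omega>))\<^sup>2 \<le> a)"
proof -
  \<comment> \<open>Integer radii suffice for local finiteness and keep the exceptional event a
    countable union.\<close>
  have "AE \<omega> in M. \<forall>m. finite {n. X n \<omega> \<noteq> 0 \<and> cmod (X n \<omega>) \<le> real m}"
    using X by (auto simp: void_process_def AE_all_countable)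
  then show ?thesis
    using void_process_hits_sector[OF X pos, of \<alpha>]
  proof eventually_elim
    case (elim \<omega>)
    have "finite {n. X n \<omega> \<in> sector \<alpha> \<beta> \<and> cmod (X n \<omega>) \<le> r}" for r
    proof (rule finite_subset)
      show "finite {n. X n \<omega> \<noteq> 0 \<and> cmod (X n \<omega>) \<le> real (nat \<lceil>r\<rceil>)}"
        using elim(1) by blast
      show "{n. X n \<omega> \<in> sector \<alpha> \<beta> \<and> cmod (X n \<omega>) \<le> r} \<subseteq>
          {n. X n \<omega> \<noteq> 0 \<and> cmod (X n \<omega>) \<le> real (nat \<lceil>r\<rceil>)}"
        using zero_notin_sector by (auto intro: order_trans[OF _ real_nat_ceiling_ge])
    qed
    then show ?case
      using nearest_le_iff[OF \<open>0 \<le> \<kappa>\<close>, of "\<lambda>n. X n \<omega>"] elim(2) by blast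
  qed
qed

text \<open>All inequalities hold together iff the process avoids one bounded set, a disjoint union
  of truncated sectors, whose area is the sum of the truncated thresholds. The \<open>max 0\<close>
  admits negative thresholds, as the independence proof ranges over all real ones.\<close>

lemma nearest_joint_survival:
  assumes X: "void_process M c X" and pos: "0 < c" "0 < \<beta>" "\<beta> \<le> 2 * pi"
    and I: "finite I" and disj: "disjoint_family_on (\<lambda>i. sector (\<alpha> i) \<beta>) I"
  shows "prob {\<omega> \<in> space M. \<forall>i\<in>I. a i < nearest (\<beta> / 2) (sector (\<alpha> i) \<beta>) (\<lambda>n. X n \<omega>)} =
    (\<Prod>i\<in>I. exp (- (c * max 0 (a i))))"
proof -
  have [measurable]: "X n \<in> borel_measurable M" for n
    by (rule void_process_measurable[OF X])
  note sector_borel [measurable]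
  have near_meas [measurable]:
    "(\<lambda>\<omega>. nearest \<kappa> (sector \<gamma> \<beta>) (\<lambda>n. X n \<omega>)) \<in> borel_measurable M" for \<kappa> \<gamma>
    by (intro nearest_process_measurable sector_borel) simp
  \<comment> \<open>The radius at which the truncated sector has area \<open>max 0 (a i)\<close>.
    For negative \<open>a i\<close> the disc shrinks to the origin, which lies in no sector.\<close>
  define r where "r i = sqrt (max 0 (a i) / (\<beta> / 2))" for i
  define B where "B = (\<Union>i\<in>I. sector (\<alpha> i) \<beta> \<inter> cball 0 (r i))"
  have in_disc: "x \<in> cball 0 (r i) \<longleftrightarrow> \<beta> / 2 * (cmod x)\<^sup>2 \<le> a i" if "x \<in> sector \<gamma> \<beta>" for x \<gamma> i
  proof -
    have "x \<noteq> 0" using that zero_notin_sector by blast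
    then have "0 < \<beta> / 2 * (cmod x)\<^sup>2" using pos by simp
    have "cmod x \<le> r i \<longleftrightarrow> (cmod x)\<^sup>2 \<le> max 0 (a i) / (\<beta> / 2)"
      unfolding r_def by (metis norm_ge_zero real_le_rsqrt real_sqrt_le_iff real_sqrt_pow2_iff
          real_sqrt_abs abs_norm_cancel)
    also have "\<dots> \<longleftrightarrow> \<beta> / 2 * (cmod x)\<^sup>2 \<le> max 0 (a i)"
      using pos by (simp add: field_simps)
    also have "\<dots> \<longleftrightarrow> \<beta> / 2 * (cmod x)\<^sup>2 \<le> a i"
      using \<open>0 < \<beta> / 2 * (cmod x)\<^sup>2\<close> by linarith
    finally show ?thesis by simp
  qed
  have B: "B \<in> sets borel" "bounded B" "0 \<notin> B"
    unfolding B_def using I bounded_sector_disc zero_notin_sector by auto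
  have "AE \<omega> in M. \<forall>i\<in>I. \<forall>a. nearest (\<beta> / 2) (sector (\<alpha> i) \<beta>) (\<lambda>n. X n \<omega>) \<le> a \<longleftrightarrow>
    (\<exists>n. X n \<omega> \<in> sector (\<alpha> i) \<beta> \<and> \<beta> / 2 * (cmod (X n \<omega>))\<^sup>2 \<le> a)"
    by (intro AE_finite_allI[OF I] nearest_le_iff_AE[OF X pos]) (use pos in simp)
  then have "AE \<omega> in M. (\<forall>i\<in>I. a i < nearest (\<beta> / 2) (sector (\<alpha> i) \<beta>) (\<lambda>n. X n \<omega>)) \<longleftrightarrow>
      (\<forall>n. X n \<omega> \<notin> B)"
  proof eventually_elim
    case (elim \<omega>)
    have "a i < nearest (\<beta> / 2) (sector (\<alpha> i) \<beta>) (\<lambda>n. X n \<omega>) \<longleftrightarrow>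
        (\<forall>n. X n \<omega> \<notin> sector (\<alpha> i) \<beta> \<inter> cball 0 (r i))" if "i \<in> I" for i
    proof -
      have "nearest (\<beta> / 2) (sector (\<alpha> i) \<beta>) (\<lambda>n. X n \<omega>) \<le> a i \<longleftrightarrow>
          (\<exists>n. X n \<omega> \<in> sector (\<alpha> i) \<beta> \<and> \<beta> / 2 * (cmod (X n \<omega>))\<^sup>2 \<le> a i)"
        using elim that by blast
      also have "\<dots> \<longleftrightarrow> (\<exists>n. X n \<omega> \<in> sector (\<alpha> i) \<beta> \<inter> cball 0 (r i))"
        using in_disc by blast
      finally show ?thesis by (metis not_le)
    qed
    then show ?case unfolding B_def by blast
  qed
  then have "prob {\<omega> \<in> space M. \<forall>i\<in>I. a i < nearest (\<beta> / 2) (sector (\<alpha> i) \<beta>) (\<lambda>n. X n \<omega>)} =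
      prob {\<omega> \<in> space M. \<forall>n. X n \<omega> \<notin> B}"
    using I B(1) by (intro finite_measure_eq_AE) (auto intro: countable_finite)
  also have "\<dots> = exp (- (c * measure lborel B))"
    by (rule void_process_prob[OF X B])
  also have "measure lborel B = (\<Sum>i\<in>I. measure lborel (sector (\<alpha> i) \<beta> \<inter> cball 0 (r i)))"
    unfolding B_def using I disj emeasure_bounded_finite[OF bounded_sector_disc]
    by (intro measure_finite_Union) (auto simp: disjoint_family_on_def less_top[symmetric])
  also have "\<dots> = (\<Sum>i\<in>I. max 0 (a i))"
    using pos by (intro sum.cong) (auto simp: measure_sector_disc r_def)
  finally show ?thesis
    using I by (simp add: exp_sum sum_distrib_left flip: sum_negf)
qed

lemma nearest_exponential:
  assumes X: "void_process M c X" and pos: "0 < c" "0 < \<beta>" "\<beta> \<le> 2 * pi"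
  shows "distributed M lborel (\<lambda>\<omega>. nearest (\<beta> / 2) (sector \<alpha> \<beta>) (\<lambda>n. X n \<omega>)) (exponential_density c)"
proof -
  have [measurable]: "X n \<in> borel_measurable M" for n
    by (rule void_process_measurable[OF X])
  have near_meas [measurable]:
    "(\<lambda>\<omega>. nearest (\<beta> / 2) (sector \<alpha> \<beta>) (\<lambda>n. X n \<omega>)) \<in> borel_measurable M"
    by (intro nearest_process_measurable sector_borel) simp
  have "prob {\<omega> \<in> space M. nearest (\<beta> / 2) (sector \<alpha> \<beta>) (\<lambda>n. X n \<omega>) \<le> a} = 1 - exp (- a * c)"
    if "0 \<le> a" for a
  proof -
    have "prob {\<omega> \<in> space M. a < nearest (\<beta> / 2) (sector \<alpha> \<beta>) (\<lambda>n. X n \<omega>)} = exp (- a * c)"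
      using nearest_joint_survival[OF X pos, of "{()}" "\<lambda>_. \<alpha>" "\<lambda>_. a"] that
      by (simp add: disjoint_family_on_def mult.commute)
    then show ?thesis
      using prob_neg[of "\<lambda>\<omega>. a < nearest (\<beta> / 2) (sector \<alpha> \<beta>) (\<lambda>n. X n \<omega>)"] by (simp add: not_less)
  qed
  then show ?thesis
    using pos by (simp add: exponential_distributed_iff near_meas)
qed

text \<open>Upper rays form an intersection-stable generator of the Borel sets, so independence need
  only be checked on survival events. Within one process it is the product form of
  \<open>nearest_joint_survival\<close>; between the processes it comes from \<open>indep\<close>.
  The index \<open>True\<close> stands for \<open>X\<close>, \<open>False\<close> for
  \<open>X'\<close>.\<close>

lemma nearest_indep_vars:
  fixes X X' :: "nat \<Rightarrow> 'a \<Rightarrow> complex"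
  assumes X: "void_process M c X" "0 < c" and X': "void_process M c' X'" "0 < c'"
    and \<beta>: "0 < \<beta>" "\<beta> \<le> 2 * pi"
    and indep: "indep_var (\<Pi>\<^sub>M n\<in>UNIV. borel) (\<lambda>\<omega> n. X n \<omega>) (\<Pi>\<^sub>M n\<in>UNIV. borel) (\<lambda>\<omega> n. X' n \<omega>)"
    and I: "finite I" "I \<noteq> {}" and disj: "disjoint_family_on (\<lambda>i. sector (\<alpha> i) \<beta>) I"
  shows "indep_vars (\<lambda>_. borel)
    (\<lambda>(b, i) \<omega>. nearest (\<beta> / 2) (sector (\<alpha> i) \<beta>) (\<lambda>n. (if b then X else X') n \<omega>)) (UNIV \<times> I)"
proof -
  note sector_borel [measurable]
  define W where "W = (\<lambda>(b, i) \<omega>. nearest (\<beta> / 2) (sector (\<alpha> i) \<beta>) (\<lambda>n. (if b then X else X') n \<omega>))"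
  define rate where "rate b = (if b then c else c')" for b
  have proc: "void_process M (rate b) (if b then X else X')" "0 < rate b" for b
    using X X' by (auto simp: rate_def)
  have X_meas [measurable]: "(if b then X else X') n \<in> borel_measurable M" for b n
    by (rule void_process_measurable[OF proc(1)])
  have W_meas [measurable]: "W j \<in> borel_measurable M" for j
    unfolding W_def case_prod_unfold
    by (intro nearest_process_measurable sector_borel X_meas)
  define G where "G j = {{\<omega> \<in> space M. a < W j \<omega>} | a. True}" for j
  have survival: "prob {\<omega> \<in> space M. \<forall>i\<in>J. a i < W (b, i) \<omega>} =
      (\<Prod>i\<in>J. prob {\<omega> \<in> space M. a i < W (b, i) \<omega>})" if "J \<subseteq> I" for b a J
  proof -
    have 1: "prob {\<omega> \<in> space M. \<forall>i\<in>K. a i < W (b, i) \<omega>} = (\<Prod>i\<in>K. exp (- (rate b * max 0 (a i))))"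
      if "K \<subseteq> I" for K
      unfolding W_def using nearest_joint_survival[OF proc(1)[of b] proc(2)[of b] \<beta>, of K \<alpha> a]
        finite_subset[OF that I(1)] disjoint_family_on_mono[OF that disj] by simp
    show ?thesis
      using 1[OF that] 1[of "{i}" for i] that by (auto intro!: prod.cong)
  qed
  have product: "prob {\<omega> \<in> space M. (\<forall>i\<in>I. a True i < W (True, i) \<omega>) \<and> (\<forall>i\<in>I. a False i < W (False, i) \<omega>)} =
      prob {\<omega> \<in> space M. \<forall>i\<in>I. a True i < W (True, i) \<omega>} *
      prob {\<omega> \<in> space M. \<forall>i\<in>I. a False i < W (False, i) \<omega>}" for a
  proof -
    define C where "C b = {f \<in> space (\<Pi>\<^sub>M n\<in>UNIV. borel). \<forall>i\<in>I. a b i < nearest (\<beta> / 2) (sector (\<alpha> i) \<beta>) f}" for b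
    have "C b \<in> sets (\<Pi>\<^sub>M n\<in>UNIV. borel)" for b
      unfolding C_def using I(1) by measurable
    from indep_varD[OF indep this[of True] this[of False]] show ?thesis
      by (auto simp: C_def W_def space_PiM vimage_def Int_def conj_commute)
  qed
  have "indep_sets G (UNIV \<times> I)"
  proof (subst indep_sets_finite)
    show "UNIV \<times> I \<noteq> ({} :: (bool \<times> _) set)" "finite (UNIV \<times> I :: (bool \<times> _) set)"
      using I by auto
    show "G j \<subseteq> events" for j
      by (auto simp: G_def)
    \<comment> \<open>Once every \<open>G j\<close> contains the whole space, the product rule for
      the full index set implies it for all subsets. The ray above \<open>-1\<close> works because
      \<open>nearest\<close> is nonnegative.\<close>
    show "space M \<in> G j" for j
      unfolding G_def
      by (rule CollectI, rule exI[of _ "-1"]) (auto simp: W_def case_prod_unfold intro: less_le_trans[OF _ nearest_nonneg])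
    show "\<forall>A\<in>Pi (UNIV \<times> I) G. prob (\<Inter>j\<in>UNIV \<times> I. A j) = (\<Prod>j\<in>UNIV \<times> I. prob (A j))"
    proof
      fix A assume "A \<in> Pi (UNIV \<times> I) G"
      then have "\<forall>j\<in>UNIV \<times> I. \<exists>a. A j = {\<omega> \<in> space M. a < W j \<omega>}"
        unfolding G_def by blast
      then obtain a where a: "\<And>j. j \<in> UNIV \<times> I \<Longrightarrow> A j = {\<omega> \<in> space M. a j < W j \<omega>}"
        by metis
      have "(\<Inter>j\<in>UNIV \<times> I. A j) =
          {\<omega> \<in> space M. (\<forall>i\<in>I. a (True, i) < W (True, i) \<omega>) \<and> (\<forall>i\<in>I. a (False, i) < W (False, i) \<omega>)}"
        using a I(2) by (auto simp: UNIV_bool)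
      then have "prob (\<Inter>j\<in>UNIV \<times> I. A j) =
          (\<Prod>i\<in>I. prob (A (True, i))) * (\<Prod>i\<in>I. prob (A (False, i)))"
        using product[of "\<lambda>b i. a (b, i)"] survival[OF subset_refl] a by simp
      also have "\<dots> = (\<Prod>j\<in>UNIV \<times> I. prob (A j))"
      proof -
        have "(\<Prod>j\<in>UNIV \<times> I. prob (A j)) = (\<Prod>b\<in>UNIV. \<Prod>i\<in>I. prob (A (b, i)))"
          by (simp add: prod.cartesian_product)
        then show ?thesis by (simp add: UNIV_bool mult.commute)
      qed
      finally show "prob (\<Inter>j\<in>UNIV \<times> I. A j) = (\<Prod>j\<in>UNIV \<times> I. prob (A j))" .
    qed
  qed
  then have "indep_sets (\<lambda>j. sigma_sets (space M) (G j)) (UNIV \<times> I)"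
  proof (rule indep_sets_sigma)
    fix j
    show "Int_stable (G j)"
    proof (rule Int_stableI)
      fix A B assume "A \<in> G j" "B \<in> G j"
      then obtain a b where "A = {\<omega> \<in> space M. a < W j \<omega>}" "B = {\<omega> \<in> space M. b < W j \<omega>}"
        unfolding G_def by blast
      then have "A \<inter> B = {\<omega> \<in> space M. max a b < W j \<omega>}" by auto
      then show "A \<inter> B \<in> G j" unfolding G_def by blast
    qed
  qed
  moreover have "sigma_sets (space M) {W j -` A \<inter> space M |A. A \<in> sets borel} \<subseteq> sigma_sets (space M) (G j)" for j
  proof (rule sigma_sets_mono, safe)
    fix A :: "real set" assume A: "A \<in> sets borel"
    have sub: "G j \<subseteq> Pow (space M)" by (auto simp: G_def)
    have "W j \<in> borel_measurable (sigma (space M) (G j))"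
    proof (rule borel_measurableI_greater)
      fix y
      have "{\<omega> \<in> space M. y < W j \<omega>} \<in> sigma_sets (space M) (G j)"
        unfolding G_def by (intro sigma_sets.Basic) blast
      then show "{\<omega> \<in> space (sigma (space M) (G j)). y < W j \<omega>} \<in> sets (sigma (space M) (G j))"
        using sub by (simp add: space_measure_of sets_measure_of)
    qed
    from measurable_sets[OF this A] show "W j -` A \<inter> space M \<in> sigma_sets (space M) (G j)"
      using sub by (simp add: space_measure_of sets_measure_of)
  qed
  ultimately have "indep_sets (\<lambda>j. sigma_sets (space M) {W j -` A \<inter> space M |A. A \<in> sets borel}) (UNIV \<times> I)"
    by (rule indep_sets_mono_sets)
  then show ?thesis
    unfolding W_def[symmetric] indep_vars_def by simp
qed

text \<open>Grouping the independent variables into one pair per sector gives independent blocks.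
  The event of each sector depends on its own block only and is evaluated by
  \<open>exponential_race\<close>. Here \<open>X\<close> plays the obstacles and \<open>X'\<close>
  the interferers.\<close>

lemma prob_race_all_sectors:
  fixes X X' :: "nat \<Rightarrow> 'a \<Rightarrow> complex"
  assumes X: "void_process M \<nu> X" "0 < \<nu>" and X': "void_process M \<mu> X'" "0 < \<mu>"
    and \<beta>: "0 < \<beta>" "\<beta> \<le> 2 * pi"
    and indep: "indep_var (\<Pi>\<^sub>M n\<in>UNIV. borel) (\<lambda>\<omega> n. X n \<omega>) (\<Pi>\<^sub>M n\<in>UNIV. borel) (\<lambda>\<omega> n. X' n \<omega>)"
    and I: "finite I" "I \<noteq> {}" and disj: "disjoint_family_on (\<lambda>i. sector (\<alpha> i) \<beta>) I"
    and t: "\<And>i. i \<in> I \<Longrightarrow> 0 \<le> t i" "\<And>i. i \<in> I \<Longrightarrow> t i \<le> \<delta>"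
  defines "U i \<omega> \<equiv> nearest (\<beta> / 2) (sector (\<alpha> i) \<beta>) (\<lambda>n. X' n \<omega>)"
    and "V i \<omega> \<equiv> nearest (\<beta> / 2) (sector (\<alpha> i) \<beta>) (\<lambda>n. X n \<omega>)"
  shows "prob {\<omega> \<in> space M. \<forall>i\<in>I. t i < V i \<omega> \<and> \<not> (U i \<omega> \<le> \<delta> \<and> U i \<omega> < V i \<omega>)} =
    (\<Prod>i\<in>I. exp (- \<nu> * t i) * exp (- \<mu> * t i) -
      \<mu> / (\<mu> + \<nu>) * (exp (- (\<mu> + \<nu>) * t i) - exp (- (\<mu> + \<nu>) * \<delta>)))"
proof -
  have U_eq: "U i = (\<lambda>\<omega>. nearest (\<beta> / 2) (sector (\<alpha> i) \<beta>) (\<lambda>n. X' n \<omega>))"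
    and V_eq: "V i = (\<lambda>\<omega>. nearest (\<beta> / 2) (sector (\<alpha> i) \<beta>) (\<lambda>n. X n \<omega>))" for i
    by (simp_all add: U_def V_def fun_eq_iff)
  define W where "W = (\<lambda>(b, i) \<omega>. nearest (\<beta> / 2) (sector (\<alpha> i) \<beta>) (\<lambda>n. (if b then X else X') n \<omega>))"
  have W: "indep_vars (\<lambda>_. borel) W (UNIV \<times> I)"
    unfolding W_def by (rule nearest_indep_vars[OF X X' \<beta> indep I disj])
  define Q where "Q i f \<longleftrightarrow> t i < f (True, i) \<and> \<not> (f (False, i) \<le> \<delta> \<and> f (False, i) < f (True, i))"
    for i and f :: "bool \<times> 'b \<Rightarrow> real"
  have "indep_vars (\<lambda>i. \<Pi>\<^sub>M j\<in>UNIV \<times> {i}. borel) (\<lambda>i \<omega>. restrict (\<lambda>j. W j \<omega>) (UNIV \<times> {i})) I"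
    by (rule indep_vars_restrict[OF W]) (auto simp: disjoint_family_on_def)
  moreover have "Q i \<in> measurable (\<Pi>\<^sub>M j\<in>UNIV \<times> {i}. borel) (count_space UNIV)" for i
    unfolding Q_def by measurable
  ultimately have "indep_vars (\<lambda>_. count_space UNIV) (\<lambda>i \<omega>. Q i (restrict (\<lambda>j. W j \<omega>) (UNIV \<times> {i}))) I"
    by (rule indep_vars_compose2)
  from indep_varsD_finite[OF this I(2,1), of "\<lambda>_. {True}"]
  have "prob (\<Inter>i\<in>I. (\<lambda>\<omega>. Q i (restrict (\<lambda>j. W j \<omega>) (UNIV \<times> {i}))) -` {True} \<inter> space M) =
      (\<Prod>i\<in>I. prob ((\<lambda>\<omega>. Q i (restrict (\<lambda>j. W j \<omega>) (UNIV \<times> {i}))) -` {True} \<inter> space M))"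
    by simp
  moreover have "(\<Inter>i\<in>I. (\<lambda>\<omega>. Q i (restrict (\<lambda>j. W j \<omega>) (UNIV \<times> {i}))) -` {True} \<inter> space M) =
      {\<omega> \<in> space M. \<forall>i\<in>I. t i < V i \<omega> \<and> \<not> (U i \<omega> \<le> \<delta> \<and> U i \<omega> < V i \<omega>)}"
    using I(2) by (auto simp: Q_def U_def V_def W_def)
  moreover have "prob ((\<lambda>\<omega>. Q i (restrict (\<lambda>j. W j \<omega>) (UNIV \<times> {i}))) -` {True} \<inter> space M) =
      exp (- \<nu> * t i) * exp (- \<mu> * t i) -
      \<mu> / (\<mu> + \<nu>) * (exp (- (\<mu> + \<nu>) * t i) - exp (- (\<mu> + \<nu>) * \<delta>))" if i: "i \<in> I" for i
  proof -
    note sector_borel [measurable]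
    have "indep_var borel (nearest (\<beta> / 2) (sector (\<alpha> i) \<beta>) \<circ> (\<lambda>\<omega> n. X n \<omega>))
        borel (nearest (\<beta> / 2) (sector (\<alpha> i) \<beta>) \<circ> (\<lambda>\<omega> n. X' n \<omega>))"
      by (rule indep_var_compose[OF indep]) measurable
    then have VU: "indep_var borel (V i) borel (U i)"
      by (simp add: U_eq V_eq comp_def)
    have UV: "indep_var borel (U i) borel (V i)"
      by (rule indep_var_commute[OF VU])
    have "distributed M lborel (U i) (exponential_density \<mu>)" "distributed M lborel (V i) (exponential_density \<nu>)"
      unfolding U_eq V_eq by (rule nearest_exponential[OF X' \<beta>] nearest_exponential[OF X \<beta>])+
    from exponential_race[OF UV this X'(2) X(2) t[OF i]]
    show ?thesis
      by (simp add: Q_def U_def V_def W_def vimage_def Int_def conj_commute)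
  qed
  ultimately show ?thesis by simp
qed

end

section \<open>Interferers and obstacles of the slotted ALOHA model\<close>

context slotted_aloha
begin

section \<open>Families of random sources and their independence\<close>

definition source_events :: "source \<Rightarrow> 'w set set" where
  "source_events s = (case s of
         Transmitter_Positions \<Rightarrow>
           sets (vimage_algebra (space M) (\<lambda>\<omega> n. T n \<omega>) (Pi\<^sub>M UNIV (\<lambda>_. borel)))
       | Obstacle_Positions \<Rightarrow>
           sets (vimage_algebra (space M) (\<lambda>\<omega> n. Ob n \<omega>) (Pi\<^sub>M UNIV (\<lambda>_. borel)))
       | Activity n \<Rightarrow> sets (vimage_algebra (space M) (act n) (count_space UNIV))
       | Aim n \<Rightarrow> sets (vimage_algebra (space M) (aim n) (count_space UNIV))
       | Link_Length \<Rightarrow> sets (vimage_algebra (space M) (\<lambda>\<omega>. cmod (Y \<omega>)) borel)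
       | Link_Activity \<Rightarrow> sets (vimage_algebra (space M) act\<^sub>0 (count_space UNIV)))"

text \<open>The information carried jointly by the sources in \<open>J\<close>. Independence of two
  quantities then amounts to measurability with respect to disjoint sets of sources, whatever their
  types.\<close>

definition source_algebra :: "source set \<Rightarrow> 'w measure" where
  "source_algebra J = sigma (space M) (\<Union>s\<in>J. source_events s)"

lemma indep_source_events: "indep_sets source_events UNIV"
  using independence unfolding source_events_def[abs_def] .

lemma source_events_subset: "source_events s \<subseteq> events"
  using indep_source_events by (simp add: indep_sets_def)

lemma space_source_algebra [simp]: "space (source_algebra J) = space M"
  by (simp add: source_algebra_def space_measure_of_conv)

lemma sets_source_algebra:
  "sets (source_algebra J) = sigma_sets (space M) (\<Union>s\<in>J. source_events s)"
proof -
  have "(\<Union>s\<in>J. source_events s) \<subseteq> Pow (space M)"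
    using source_events_subset sets.space_closed by blast
  then show ?thesis by (simp add: source_algebra_def sets_measure_of)
qed

lemma source_algebra_mono: "sets (source_algebra J) \<subseteq> events"
  unfolding sets_source_algebra using source_events_subset by (intro sets.sigma_sets_subset) blast

lemma measurable_from_source_algebra: "f \<in> measurable (source_algebra J) N \<Longrightarrow> f \<in> measurable M N"
  using source_algebra_mono[of J] by (auto simp: measurable_def)

lemma measurable_source_algebraI:
  assumes "f \<in> measurable (vimage_algebra (space M) g K) N"
    "sets (vimage_algebra (space M) g K) = source_events s" "s \<in> J"
  shows "f \<in> measurable (source_algebra J) N"
  using assms unfolding measurable_def sets_source_algebra by (auto intro!: sigma_sets.Basic)

lemma source_measurable:
  shows T_source: "Transmitter_Positions \<in> J \<Longrightarrow> T n \<in> borel_measurable (source_algebra J)"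
    and Ob_source: "Obstacle_Positions \<in> J \<Longrightarrow> Ob n \<in> borel_measurable (source_algebra J)"
    and act_source: "Activity n \<in> J \<Longrightarrow> Measurable.pred (source_algebra J) (act n)"
    and aim_source: "Aim n \<in> J \<Longrightarrow> Measurable.pred (source_algebra J) (aim n)"
    and length_source: "Link_Length \<in> J \<Longrightarrow> (\<lambda>\<omega>. cmod (Y \<omega>)) \<in> borel_measurable (source_algebra J)"
    and link_activity_source: "Link_Activity \<in> J \<Longrightarrow> Measurable.pred (source_algebra J) act\<^sub>0"
proof -
  have comp: "(\<lambda>\<omega>. X n \<omega>) \<in> borel_measurable
      (vimage_algebra (space M) (\<lambda>\<omega> n. X n \<omega>) (\<Pi>\<^sub>M n\<in>UNIV. borel))" for X :: "nat \<Rightarrow> 'w \<Rightarrow> complex"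
    by (rule measurable_compose[OF measurable_vimage_algebra1 measurable_component_singleton])
      (auto simp: space_PiM)
  show "Transmitter_Positions \<in> J \<Longrightarrow> T n \<in> borel_measurable (source_algebra J)"
    by (rule measurable_source_algebraI[OF comp]) (auto simp: source_events_def)
  show "Obstacle_Positions \<in> J \<Longrightarrow> Ob n \<in> borel_measurable (source_algebra J)"
    by (rule measurable_source_algebraI[OF comp]) (auto simp: source_events_def)
  show "Activity n \<in> J \<Longrightarrow> Measurable.pred (source_algebra J) (act n)"
    by (rule measurable_source_algebraI[OF measurable_vimage_algebra1]) (auto simp: source_events_def)
  show "Aim n \<in> J \<Longrightarrow> Measurable.pred (source_algebra J) (aim n)"
    by (rule measurable_source_algebraI[OF measurable_vimage_algebra1]) (auto simp: source_events_def)
  show "Link_Length \<in> J \<Longrightarrow> (\<lambda>\<omega>. cmod (Y \<omega>)) \<in> borel_measurable (source_algebra J)"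
    by (rule measurable_source_algebraI[OF measurable_vimage_algebra1]) (auto simp: source_events_def)
  show "Link_Activity \<in> J \<Longrightarrow> Measurable.pred (source_algebra J) act\<^sub>0"
    by (rule measurable_source_algebraI[OF measurable_vimage_algebra1]) (auto simp: source_events_def)
qed

text \<open>Each \<open>source_events s\<close> is a sigma-algebra, hence intersection-stable, so
  independence survives grouping into disjoint blocks.\<close>

lemma indep_sets_source_algebra:
  assumes "disjoint_family_on J I"
  shows "indep_sets (\<lambda>i. sets (source_algebra (J i))) I"
  unfolding sets_source_algebra
proof (rule indep_sets_collect_sigma[OF _ _ assms])
  show "indep_sets source_events (\<Union>i\<in>I. J i)"
    by (rule indep_sets_mono_index[OF _ indep_source_events]) simp
  show "Int_stable (source_events s)" for s
    unfolding source_events_def by (cases s) (auto intro: sets.Int_stable)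
qed

lemma indep_var_source_algebra:
  assumes "J \<inter> K = {}" and X: "X \<in> measurable (source_algebra J) N"
    and Z: "Z \<in> measurable (source_algebra K) N'"
  shows "indep_var N X N' Z"
proof -
  have "disjoint_family_on (case_bool J K) UNIV"
    using assms(1) by (auto simp: disjoint_family_on_def split: bool.split)
  from indep_sets_source_algebra[OF this]
  have indep: "indep_set (sets (source_algebra J)) (sets (source_algebra K))"
    unfolding indep_set_def by (rule indep_sets_mono_sets) (auto split: bool.split)
  have sub: "sigma_sets (space M) {f -` A \<inter> space M |A. A \<in> sets N} \<subseteq> sets (source_algebra J)"
    if "f \<in> measurable (source_algebra J) N" for f :: "'w \<Rightarrow> 'z" and N J
    using that sets.sigma_sets_subset[of "{f -` A \<inter> space M |A. A \<in> sets N}" "source_algebra J"]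
    by (auto simp: measurable_def)
  show ?thesis
    unfolding indep_var_eq indep_sets2_eq
  proof (intro conjI ballI)
    show "X \<in> measurable M N" "Z \<in> measurable M N'"
      using X Z by (blast intro: measurable_from_source_algebra)+
    show "sigma_sets (space M) {X -` A \<inter> space M |A. A \<in> sets N} \<subseteq> events"
      "sigma_sets (space M) {Z -` A \<inter> space M |A. A \<in> sets N'} \<subseteq> events"
      by (rule order_trans[OF sub[OF X] source_algebra_mono] order_trans[OF sub[OF Z] source_algebra_mono])+
    fix a b
    assume "a \<in> sigma_sets (space M) {X -` A \<inter> space M |A. A \<in> sets N}"
      "b \<in> sigma_sets (space M) {Z -` A \<inter> space M |A. A \<in> sets N'}"
    then have "a \<in> sets (source_algebra J)" "b \<in> sets (source_algebra K)"
      by (simp_all only: subsetD[OF sub[OF X]] subsetD[OF sub[OF Z]])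
    then show "prob (a \<inter> b) = prob a * prob b"
      using indep unfolding indep_sets2_eq by simp
  qed
qed

text \<open>Discarded transmitters are moved to the origin, which lies in no sector.\<close>

definition thinned :: "nat \<Rightarrow> 'w \<Rightarrow> complex" where
  "thinned n \<omega> = (if act n \<omega> \<and> aim n \<omega> then T n \<omega> else 0)"

lemma interferers_iff_thinned:
  assumes "0 \<notin> S"
  shows "(\<exists>x\<in>interferers T act aim \<omega>. x \<in> S \<and> P x) \<longleftrightarrow> (\<exists>n. thinned n \<omega> \<in> S \<and> P (thinned n \<omega>))"
proof
  assume "\<exists>x\<in>interferers T act aim \<omega>. x \<in> S \<and> P x"
  then obtain n where "act n \<omega>" "aim n \<omega>" "T n \<omega> \<in> S" "P (T n \<omega>)"
    unfolding interferers_def by blast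
  then show "\<exists>n. thinned n \<omega> \<in> S \<and> P (thinned n \<omega>)"
    by (intro exI[of _ n]) (simp add: thinned_def)
next
  assume "\<exists>n. thinned n \<omega> \<in> S \<and> P (thinned n \<omega>)"
  then obtain n where n: "thinned n \<omega> \<in> S" "P (thinned n \<omega>)" by blast
  then have "thinned n \<omega> = T n \<omega>" "act n \<omega>" "aim n \<omega>"
    using assms by (auto simp: thinned_def split: if_splits)
  then show "\<exists>x\<in>interferers T act aim \<omega>. x \<in> S \<and> P x"
    using n unfolding interferers_def by (intro bexI[of _ "T n \<omega>"]) auto
qed

lemma thinned_source:
  assumes "Transmitter_Positions \<in> J" "range Activity \<subseteq> J" "range Aim \<subseteq> J"
  shows "thinned n \<in> borel_measurable (source_algebra J)"
proof -
  have [measurable]: "T n \<in> borel_measurable (source_algebra J)"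
    "Measurable.pred (source_algebra J) (act n)" "Measurable.pred (source_algebra J) (aim n)"
    using assms by (auto intro!: source_measurable)
  show ?thesis unfolding thinned_def by measurable
qed

lemma thinned_measurable [measurable]: "thinned n \<in> borel_measurable M"
  by (rule measurable_from_source_algebra[OF thinned_source[of UNIV]]) auto

lemma Ob_measurable [measurable]: "Ob n \<in> borel_measurable M"
  using obstacles by (simp add: poisson_point_process_def)

text \<open>The mark of transmitter \<open>n\<close> is the conjunction of \<open>act n\<close> and
  \<open>aim n\<close>; by independence it holds with probability
  \<open>\<rho>\<^sub>a * (\<theta> / (2 * pi))\<close>, the retention probability of the
  thinning.\<close>

lemma void_process_thinned: "void_process M (\<rho>\<^sub>a * lam\<^sub>t * \<theta> / (2 * pi)) thinned"
  unfolding void_process_def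
proof (intro conjI allI impI)
  fix r
  have "AE \<omega> in M. finite {n. cmod (T n \<omega>) \<le> r}"
    using transmitters by (simp add: poisson_point_process_def)
  then show "AE \<omega> in M. finite {n. thinned n \<omega> \<noteq> 0 \<and> cmod (thinned n \<omega>) \<le> r}"
    by (rule AE_mp) (auto simp: thinned_def intro: rev_finite_subset)
next
  fix B :: "complex set" assume B: "B \<in> sets borel" "bounded B" "0 \<notin> B"
  have "prob {\<omega> \<in> space M. \<forall>n. act n \<omega> \<and> aim n \<omega> \<longrightarrow> T n \<omega> \<notin> B} =
      exp (- (lam\<^sub>t * (\<rho>\<^sub>a * (\<theta> / (2 * pi))) * measure lborel B))"
  proof (rule thinned_void_probability[OF transmitters _ _ B(1,2)])
    \<comment> \<open>Disjoint blocks of sources: positions in one, both marks of transmitter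
      \<open>n\<close> together in another.\<close>
    define J where "J = case_option {Transmitter_Positions} (\<lambda>n. {Activity n, Aim n})"
    have "disjoint_family_on J UNIV"
      by (auto simp: disjoint_family_on_def J_def split: option.split)
    then have "indep_sets (\<lambda>i. sets (source_algebra (J i))) UNIV"
      by (rule indep_sets_source_algebra)
    then show "indep_sets (case_option
        (sets (vimage_algebra (space M) (\<lambda>\<omega> n. T n \<omega>) (\<Pi>\<^sub>M n\<in>UNIV. borel)))
        (\<lambda>n. {{\<omega> \<in> space M. \<not> (act n \<omega> \<and> aim n \<omega>)}})) UNIV"
    proof (rule indep_sets_mono_sets)
      fix i
      show "case_option
        (sets (vimage_algebra (space M) (\<lambda>\<omega> n. T n \<omega>) (\<Pi>\<^sub>M n\<in>UNIV. borel)))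
        (\<lambda>n. {{\<omega> \<in> space M. \<not> (act n \<omega> \<and> aim n \<omega>)}}) i \<subseteq> sets (source_algebra (J i))"
      proof (cases i)
        case None
        then show ?thesis
          by (auto simp: J_def sets_source_algebra source_events_def)
      next
        case (Some n)
        have [measurable]: "Measurable.pred (source_algebra (J i)) (act n)"
          "Measurable.pred (source_algebra (J i)) (aim n)"
          using Some by (auto intro!: source_measurable simp: J_def)
        have "{\<omega> \<in> space (source_algebra (J i)). \<not> (act n \<omega> \<and> aim n \<omega>)} \<in> sets (source_algebra (J i))"
          by measurable
        then show ?thesis using Some by simp
      qed
    qed
    fix n
    have "indep_var (count_space UNIV) (act n) (count_space UNIV) (aim n)"
      by (rule indep_var_source_algebra[of "{Activity n}" "{Aim n}"]) (auto intro: source_measurable)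
    from indep_varD[OF this, of "{True}" "{True}"]
    have both: "prob {\<omega> \<in> space M. act n \<omega> \<and> aim n \<omega>} = \<rho>\<^sub>a * (\<theta> / (2 * pi))"
      using active(2)[of n] aimed(2)[of n] by (simp add: vimage_def Int_def conj_commute)
    have [measurable]: "Measurable.pred M (act n)" "Measurable.pred M (aim n)"
      using active aimed by auto
    show "prob {\<omega> \<in> space M. \<not> (act n \<omega> \<and> aim n \<omega>)} = 1 - \<rho>\<^sub>a * (\<theta> / (2 * pi))"
      using prob_neg[of "\<lambda>\<omega>. act n \<omega> \<and> aim n \<omega>"] both by simp
  qed
  moreover have "{\<omega> \<in> space M. \<forall>n. thinned n \<omega> \<notin> B} =
      {\<omega> \<in> space M. \<forall>n. act n \<omega> \<and> aim n \<omega> \<longrightarrow> T n \<omega> \<notin> B}"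
    using B(3) by (auto simp: thinned_def)
  ultimately show "prob {\<omega> \<in> space M. \<forall>n. thinned n \<omega> \<notin> B} =
      exp (- (\<rho>\<^sub>a * lam\<^sub>t * \<theta> / (2 * pi) * measure lborel B))"
    by (simp add: algebra_simps)
qed simp

text \<open>A zero \<open>point_count\<close> could also come from infinitely many points; local
  finiteness excludes this almost surely.\<close>

lemma void_process_Ob: "void_process M lam\<^sub>o Ob"
  unfolding void_process_def
proof (intro conjI allI impI)
  have fin: "AE \<omega> in M. finite {n. cmod (Ob n \<omega>) \<le> r}" for r
    using obstacles by (simp add: poisson_point_process_def)
  show "AE \<omega> in M. finite {n. Ob n \<omega> \<noteq> 0 \<and> cmod (Ob n \<omega>) \<le> r}" for r
    by (rule AE_mp[OF fin[of r]]) (auto intro: rev_finite_subset)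
  fix B :: "complex set" assume B: "B \<in> sets borel" "bounded B" "0 \<notin> B"
  note [measurable] = B(1)
  obtain r where r: "\<And>x. x \<in> B \<Longrightarrow> cmod x \<le> r"
    using B(2) unfolding bounded_iff by auto
  have P: "prob {\<omega> \<in> space M. point_count Ob B \<omega> = 0} = exp (- (lam\<^sub>o * measure lborel B))"
    using obstacles B by (simp add: poisson_point_process_def)
  have "AE \<omega> in M. finite {n. Ob n \<omega> \<in> B}"
    by (rule AE_mp[OF fin[of r]]) (use r in \<open>auto intro: rev_finite_subset\<close>)
  then have "AE \<omega> in M. (\<forall>n. Ob n \<omega> \<notin> B) \<longleftrightarrow> point_count Ob B \<omega> = 0"
    by eventually_elim (auto simp: point_count_def)
  \<comment> \<open>A non-measurable set would get measure \<open>0\<close>, but the Poisson value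
    is an exponential and hence positive.\<close>
  moreover have "{\<omega> \<in> space M. point_count Ob B \<omega> = 0} \<in> events"
    by (rule ccontr) (use P in \<open>simp add: measure_notin_sets\<close>)
  ultimately have "prob {\<omega> \<in> space M. \<forall>n. Ob n \<omega> \<notin> B} = prob {\<omega> \<in> space M. point_count Ob B \<omega> = 0}"
    by (intro finite_measure_eq_AE) auto
  then show "prob {\<omega> \<in> space M. \<forall>n. Ob n \<omega> \<notin> B} = exp (- (lam\<^sub>o * measure lborel B))"
    using P by simp
qed simp

lemma indep_var_obstacles_interferers:
  "indep_var (\<Pi>\<^sub>M n\<in>UNIV. borel) (\<lambda>\<omega> n. Ob n \<omega>) (\<Pi>\<^sub>M n\<in>UNIV. borel) (\<lambda>\<omega> n. thinned n \<omega>)"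
  by (rule indep_var_source_algebra[of "{Obstacle_Positions}" "{Transmitter_Positions} \<union> range Activity \<union> range Aim"])
    (auto intro!: measurable_PiM_single' Ob_source thinned_source simp: space_PiM)

section \<open>Link establishment and collision as measurable events\<close>

lemma subsector_borel [measurable]: "subsector \<alpha> \<theta>\<^sub>c i \<in> sets borel"
  by (simp add: subsector_def sector_borel)

lemma zero_notin_subsector: "0 \<notin> subsector \<alpha> \<theta>\<^sub>c i"
  by (simp add: subsector_def zero_notin_sector)

lemma established_iff:
  "established l \<omega> \<longleftrightarrow> \<not> (\<exists>n. Ob n \<omega> \<in> subsector \<alpha> \<theta>\<^sub>c (num_sectors \<theta> \<theta>\<^sub>c) \<and> cmod (Ob n \<omega>) \<le> l)"
  by (auto simp: established_def clear_upto_def points_def)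

lemma collision_iff:
  "collision \<omega> \<longleftrightarrow> (\<exists>i\<in>{1..num_sectors \<theta> \<theta>\<^sub>c}. \<exists>n. thinned n \<omega> \<in> subsector \<alpha> \<theta>\<^sub>c i \<and>
    cmod (thinned n \<omega>) \<le> d_max \<and>
    \<not> (\<exists>m. Ob m \<omega> \<in> subsector \<alpha> \<theta>\<^sub>c i \<and> cmod (Ob m \<omega>) \<le> cmod (thinned n \<omega>)))"
  unfolding collision_def collides_def
  by (subst interferers_iff_thinned[OF zero_notin_subsector]) (auto simp: clear_upto_def points_def)

text \<open>The radius \<open>f\<close> may be random, which covers both a fixed length and
  \<open>cmod (Y \<omega>)\<close>.\<close>

lemma established_source:
  assumes "Obstacle_Positions \<in> J" "f \<in> borel_measurable (source_algebra J)"
  shows "Measurable.pred (source_algebra J) (\<lambda>\<omega>. established (f \<omega>) \<omega>)"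
proof -
  have [measurable]: "Ob n \<in> borel_measurable (source_algebra J)" for n
    using assms(1) by (rule Ob_source)
  note assms(2) [measurable]
  show ?thesis unfolding established_iff by measurable
qed

lemma collision_source:
  assumes "Obstacle_Positions \<in> J" "Transmitter_Positions \<in> J" "range Activity \<subseteq> J" "range Aim \<subseteq> J"
  shows "Measurable.pred (source_algebra J) collision"
proof -
  have [measurable]: "Ob n \<in> borel_measurable (source_algebra J)"
    "thinned n \<in> borel_measurable (source_algebra J)" for n
    using assms by (auto intro: Ob_source thinned_source)
  show ?thesis unfolding collision_iff[abs_def] by measurable
qed

lemma collision_measurable [measurable]: "Measurable.pred M collision"
  by (rule measurable_from_source_algebra[OF collision_source[of UNIV]]) auto

lemma established_measurable [measurable]: "Measurable.pred M (established l)"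
  by (rule measurable_from_source_algebra[OF established_source[of UNIV]]) auto

text \<open>The activity of the typical transmitter is a source of its own, and the rest of the
  success event is measurable in the remaining sources.\<close>

lemma throughput_eq_prob:
  "throughput = \<rho>\<^sub>a * prob {\<omega> \<in> space M. established (cmod (Y \<omega>)) \<omega> \<and> \<not> collision \<omega>}"
proof -
  define J where "J = UNIV - {Link_Activity}"
  have [measurable]: "Measurable.pred (source_algebra J) (\<lambda>\<omega>. established (cmod (Y \<omega>)) \<omega>)"
    "Measurable.pred (source_algebra J) collision"
    by (auto intro!: established_source collision_source length_source simp: J_def)
  have "indep_var (count_space UNIV) act\<^sub>0 (count_space UNIV)
      (\<lambda>\<omega>. established (cmod (Y \<omega>)) \<omega> \<and> \<not> collision \<omega>)"
    by (rule indep_var_source_algebra[of "{Link_Activity}" J])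
      (simp add: J_def, rule link_activity_source, simp, measurable)
  from indep_varD[OF this, of "{True}" "{True}"] show ?thesis
    using link_active(2)
    by (simp add: throughput_def successful_def vimage_def Int_def conj_commute conj_left_commute)
qed

end

section \<open>Collision probability and throughput\<close>

lemma disjoint_subsectors:
  assumes "0 < \<theta>\<^sub>c" "real k * \<theta>\<^sub>c \<le> 2 * pi"
  shows "disjoint_family_on (subsector \<alpha> \<theta>\<^sub>c) {1..k}"
proof -
  have less: "subsector \<alpha> \<theta>\<^sub>c i \<inter> subsector \<alpha> \<theta>\<^sub>c j = {}" if "1 \<le> i" "i < j" "j \<le> k" for i j
    unfolding subsector_def
  proof (rule sector_disjoint)
    have "real i * \<theta>\<^sub>c \<le> (real j - 1) * \<theta>\<^sub>c" "real j * \<theta>\<^sub>c \<le> real k * \<theta>\<^sub>c" "0 \<le> (real i - 1) * \<theta>\<^sub>c"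
      using that assms(1) by (auto intro!: mult_right_mono)
    then show "\<alpha> + (real i - 1) * \<theta>\<^sub>c + \<theta>\<^sub>c \<le> \<alpha> + (real j - 1) * \<theta>\<^sub>c"
      "\<alpha> + (real j - 1) * \<theta>\<^sub>c + \<theta>\<^sub>c \<le> \<alpha> + (real i - 1) * \<theta>\<^sub>c + 2 * pi"
      using assms(2) by (simp_all add: algebra_simps)
  qed
  show ?thesis
    unfolding disjoint_family_on_def
  proof (intro ballI impI)
    fix i j assume "i \<in> {1..k}" "j \<in> {1..k}" "i \<noteq> j"
    then show "subsector \<alpha> \<theta>\<^sub>c i \<inter> subsector \<alpha> \<theta>\<^sub>c j = {}"
      using less[of i j] less[of j i] by (cases "i < j") auto
  qed
qed

text \<open>With obstacle density \<open>\<nu>\<close> and interferer density \<open>\<mu>\<close>: the probability that a sector has no obstacle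
  up to area \<open>t\<close> and no interferer in line of sight up to area \<open>\<delta>\<close>.\<close>

definition clear_sector_prob :: "real \<Rightarrow> real \<Rightarrow> real \<Rightarrow> real \<Rightarrow> real" where
  "clear_sector_prob \<nu> \<mu> \<delta> t = exp (- \<nu> * t) * exp (- \<mu> * t) -
      \<mu> / (\<mu> + \<nu>) * (exp (- (\<mu> + \<nu>) * t) - exp (- (\<mu> + \<nu>) * \<delta>))"

context slotted_aloha
begin

context
  fixes lam\<^sub>I and k :: nat
  assumes pos: "0 < lam\<^sub>t" "0 < lam\<^sub>o" "0 < \<rho>\<^sub>a" "0 < d_max" "0 < \<theta>" "\<theta> \<le> 2 * pi" "0 < \<theta>\<^sub>c"
    and k: "0 < k" "\<theta> / \<theta>\<^sub>c = real k"
    and lam\<^sub>I: "lam\<^sub>I = \<rho>\<^sub>a * lam\<^sub>t * \<theta> / (2 * pi)"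
begin

lemma lamI_pos: "0 < lam\<^sub>I"
  using pos by (simp add: lam\<^sub>I)

lemma num_sectors_eq: "num_sectors \<theta> \<theta>\<^sub>c = k"
  by (simp add: num_sectors_def k)

lemma \<theta>_eq: "real k * \<theta>\<^sub>c = \<theta>"
  using k pos by (simp add: field_simps)

lemma \<theta>\<^sub>c_le: "\<theta>\<^sub>c \<le> 2 * pi"
proof -
  have "1 * \<theta>\<^sub>c \<le> real k * \<theta>\<^sub>c" using k pos by (intro mult_right_mono) auto
  then show ?thesis using \<theta>_eq pos by linarith
qed

text \<open>The variables \<open>V\<close> and, in \<open>intf\<close> below, \<open>U\<close> of
  the overview; the weight \<open>\<theta>\<^sub>c / 2\<close> turns squared distance into sector
  area.\<close>

definition obst :: "nat \<Rightarrow> 'w \<Rightarrow> real" where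
  "obst i \<omega> = nearest (\<theta>\<^sub>c / 2) (subsector \<alpha> \<theta>\<^sub>c i) (\<lambda>n. Ob n \<omega>)"

definition intf :: "nat \<Rightarrow> 'w \<Rightarrow> real" where
  "intf i \<omega> = nearest (\<theta>\<^sub>c / 2) (subsector \<alpha> \<theta>\<^sub>c i) (\<lambda>n. thinned n \<omega>)"

lemma obst_measurable [measurable]: "obst i \<in> borel_measurable M"
  unfolding obst_def[abs_def] by (rule nearest_process_measurable) auto

lemma intf_measurable [measurable]: "intf i \<in> borel_measurable M"
  unfolding intf_def[abs_def] by (rule nearest_process_measurable) auto

lemma obst_le_iff_AE: "AE \<omega> in M. \<forall>i. \<forall>a. obst i \<omega> \<le> a \<longleftrightarrow>
    (\<exists>n. Ob n \<omega> \<in> subsector \<alpha> \<theta>\<^sub>c i \<and> \<theta>\<^sub>c / 2 * (cmod (Ob n \<omega>))\<^sup>2 \<le> a)"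
  unfolding obst_def subsector_def AE_all_countable
  using pos by (intro allI nearest_le_iff_AE[OF void_process_Ob _ _ \<theta>\<^sub>c_le]) auto

lemma intf_le_iff_AE: "AE \<omega> in M. \<forall>i. \<forall>a. intf i \<omega> \<le> a \<longleftrightarrow>
    (\<exists>n. thinned n \<omega> \<in> subsector \<alpha> \<theta>\<^sub>c i \<and> \<theta>\<^sub>c / 2 * (cmod (thinned n \<omega>))\<^sup>2 \<le> a)"
  unfolding intf_def subsector_def AE_all_countable
  using pos lamI_pos
  by (intro allI nearest_le_iff_AE[OF void_process_thinned _ _ \<theta>\<^sub>c_le]) (auto simp: lam\<^sub>I)

lemma weight_le_iff: "0 \<le> l \<Longrightarrow> \<theta>\<^sub>c / 2 * (cmod x)\<^sup>2 \<le> \<theta>\<^sub>c / 2 * l\<^sup>2 \<longleftrightarrow> cmod x \<le> l"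
  using pos by (simp add: power_mono_iff)

text \<open>The null event is uniform in \<open>l\<close>, so that the random link length can be
  inserted for \<open>l\<close>.\<close>

lemma established_iff_AE:
  "AE \<omega> in M. \<forall>l\<ge>0. established l \<omega> \<longleftrightarrow> \<theta>\<^sub>c / 2 * l\<^sup>2 < obst k \<omega>"
  using obst_le_iff_AE
proof eventually_elim
  case (elim \<omega>)
  show ?case
  proof (intro allI impI)
    fix l :: real assume "0 \<le> l"
    have "obst k \<omega> \<le> \<theta>\<^sub>c / 2 * l\<^sup>2 \<longleftrightarrow> (\<exists>n. Ob n \<omega> \<in> subsector \<alpha> \<theta>\<^sub>c k \<and> cmod (Ob n \<omega>) \<le> l)"
      using elim weight_le_iff[OF \<open>0 \<le> l\<close>] by blast
    then show "established l \<omega> \<longleftrightarrow> \<theta>\<^sub>c / 2 * l\<^sup>2 < obst k \<omega>"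
      unfolding established_iff num_sectors_eq by (metis not_le)
  qed
qed

text \<open>If any interferer of a sector is within range and in line of sight, so is the nearest
  one. The comparison with \<open>obst\<close> is strict because an obstacle at equal distance
  already blocks.\<close>

lemma collision_iff_AE:
  "AE \<omega> in M. collision \<omega> \<longleftrightarrow>
    (\<exists>i\<in>{1..k}. intf i \<omega> \<le> \<theta>\<^sub>c / 2 * d_max\<^sup>2 \<and> intf i \<omega> < obst i \<omega>)"
  using obst_le_iff_AE intf_le_iff_AE
proof eventually_elim
  case (elim \<omega>)
  have "(\<exists>n. thinned n \<omega> \<in> subsector \<alpha> \<theta>\<^sub>c i \<and> cmod (thinned n \<omega>) \<le> d_max \<and>
      \<not> (\<exists>m. Ob m \<omega> \<in> subsector \<alpha> \<theta>\<^sub>c i \<and> cmod (Ob m \<omega>) \<le> cmod (thinned n \<omega>))) \<longleftrightarrow>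
      intf i \<omega> \<le> \<theta>\<^sub>c / 2 * d_max\<^sup>2 \<and> intf i \<omega> < obst i \<omega>" (is "?L \<longleftrightarrow> ?R") for i
  proof
    assume ?L
    then obtain n where n: "thinned n \<omega> \<in> subsector \<alpha> \<theta>\<^sub>c i" "cmod (thinned n \<omega>) \<le> d_max"
      "\<not> (\<exists>m. Ob m \<omega> \<in> subsector \<alpha> \<theta>\<^sub>c i \<and> cmod (Ob m \<omega>) \<le> cmod (thinned n \<omega>))"
      by blast
    have "intf i \<omega> \<le> \<theta>\<^sub>c / 2 * (cmod (thinned n \<omega>))\<^sup>2"
      using elim(2) n(1) by blast
    moreover have "\<theta>\<^sub>c / 2 * (cmod (thinned n \<omega>))\<^sup>2 \<le> \<theta>\<^sub>c / 2 * d_max\<^sup>2"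
      using weight_le_iff[of d_max] n(2) pos by simp
    moreover have "\<not> obst i \<omega> \<le> \<theta>\<^sub>c / 2 * (cmod (thinned n \<omega>))\<^sup>2"
      using elim(1) n(3) weight_le_iff[OF norm_ge_zero] by blast
    ultimately show ?R by linarith
  next
    assume R: ?R
    \<comment> \<open>The random threshold \<open>a = intf i \<omega>\<close> yields an interferer
      attaining the minimum.\<close>
    then obtain n where n: "thinned n \<omega> \<in> subsector \<alpha> \<theta>\<^sub>c i" "\<theta>\<^sub>c / 2 * (cmod (thinned n \<omega>))\<^sup>2 \<le> intf i \<omega>"
      using elim(2) by blast
    then have "cmod (thinned n \<omega>) \<le> d_max"
      using R weight_le_iff[of d_max] pos by (meson less_imp_le order_trans)
    moreover have "\<not> obst i \<omega> \<le> \<theta>\<^sub>c / 2 * (cmod (thinned n \<omega>))\<^sup>2"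
      using R n by linarith
    then have "\<not> (\<exists>m. Ob m \<omega> \<in> subsector \<alpha> \<theta>\<^sub>c i \<and> cmod (Ob m \<omega>) \<le> cmod (thinned n \<omega>))"
      using elim(1) weight_le_iff[OF norm_ge_zero] by blast
    ultimately show ?L using n by blast
  qed
  then show ?case
    unfolding collision_iff num_sectors_eq by blast
qed

section \<open>Evaluation of the probabilities and of the throughput integral\<close>

lemma prob_established:
  assumes "0 \<le> l"
  shows "prob {\<omega> \<in> space M. established l \<omega>} = exp (- lam\<^sub>o * (\<theta>\<^sub>c / 2 * l\<^sup>2))"
proof -
  have "prob {\<omega> \<in> space M. established l \<omega>} = prob {\<omega> \<in> space M. \<theta>\<^sub>c / 2 * l\<^sup>2 < obst k \<omega>}"
    using established_iff_AE assms by (intro finite_measure_eq_AE) auto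
  also have "distributed M lborel (obst k) (exponential_density lam\<^sub>o)"
    unfolding obst_def[abs_def] subsector_def
    using pos by (intro nearest_exponential[OF void_process_Ob _ _ \<theta>\<^sub>c_le]) auto
  then have "prob {\<omega> \<in> space M. \<theta>\<^sub>c / 2 * l\<^sup>2 < obst k \<omega>} = exp (- (\<theta>\<^sub>c / 2 * l\<^sup>2) * lam\<^sub>o)"
    using pos by (intro exponential_distributedD_gt) auto
  finally show ?thesis by (simp add: mult.commute)
qed

text \<open>Establishment constrains sector \<open>k\<close> alone. Threshold \<open>0\<close> in
  the other sectors is harmless, since the nearest obstacle almost surely has positive area, and
  brings all sectors into the form of \<open>prob_race_all_sectors\<close>.\<close>

lemma prob_established_no_collision:
  assumes "0 \<le> l" "l \<le> d_max"
  shows "prob {\<omega> \<in> space M. established l \<omega> \<and> \<not> collision \<omega>} =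
    clear_sector_prob lam\<^sub>o lam\<^sub>I (\<theta>\<^sub>c / 2 * d_max\<^sup>2) 0 ^ (k - 1) *
    clear_sector_prob lam\<^sub>o lam\<^sub>I (\<theta>\<^sub>c / 2 * d_max\<^sup>2) (\<theta>\<^sub>c / 2 * l\<^sup>2)"
proof -
  let ?\<delta> = "\<theta>\<^sub>c / 2 * d_max\<^sup>2"
  define t where "t i = (if i = k then \<theta>\<^sub>c / 2 * l\<^sup>2 else 0)" for i
  have obst_pos: "AE \<omega> in M. \<forall>i. 0 < obst i \<omega>"
    using obst_le_iff_AE
  proof eventually_elim
    case (elim \<omega>)
    have "\<not> obst i \<omega> \<le> 0" for i
    proof
      assume "obst i \<omega> \<le> 0"
      then obtain n where n: "Ob n \<omega> \<in> subsector \<alpha> \<theta>\<^sub>c i" "\<theta>\<^sub>c / 2 * (cmod (Ob n \<omega>))\<^sup>2 \<le> 0"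
        using elim by blast
      then have "Ob n \<omega> = 0" using weight_le_iff[of 0 "Ob n \<omega>"] by simp
      then show False using n(1) zero_notin_subsector by simp
    qed
    then show ?case by (simp add: not_le)
  qed
  have "AE \<omega> in M. established l \<omega> \<and> \<not> collision \<omega> \<longleftrightarrow>
      (\<forall>i\<in>{1..k}. t i < obst i \<omega> \<and> \<not> (intf i \<omega> \<le> ?\<delta> \<and> intf i \<omega> < obst i \<omega>))"
    using established_iff_AE collision_iff_AE obst_pos
  proof eventually_elim
    case (elim \<omega>)
    have "established l \<omega> \<longleftrightarrow> (\<forall>i\<in>{1..k}. t i < obst i \<omega>)"
      using elim(1,3) assms(1) k(1) by (auto simp: t_def Suc_le_eq)
    then show ?case using elim(2) by blast
  qed
  then have "prob {\<omega> \<in> space M. established l \<omega> \<and> \<not> collision \<omega>} =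
      prob {\<omega> \<in> space M. \<forall>i\<in>{1..k}. t i < obst i \<omega> \<and> \<not> (intf i \<omega> \<le> ?\<delta> \<and> intf i \<omega> < obst i \<omega>)}"
    by (intro finite_measure_eq_AE) auto
  also have "\<dots> = (\<Prod>i\<in>{1..k}. clear_sector_prob lam\<^sub>o lam\<^sub>I ?\<delta> (t i))"
    unfolding clear_sector_prob_def obst_def intf_def subsector_def
  proof (rule prob_race_all_sectors)
    show "disjoint_family_on (\<lambda>i. sector (\<alpha> + (real i - 1) * \<theta>\<^sub>c) \<theta>\<^sub>c) {1..k}"
      using disjoint_subsectors[OF pos(7), of k \<alpha>] \<theta>_eq pos unfolding subsector_def[abs_def] by simp
    show "void_process M lam\<^sub>I thinned" using void_process_thinned by (simp add: lam\<^sub>I)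
    show "{1..k} \<noteq> {}" using k by simp
    show "0 \<le> t i" "t i \<le> ?\<delta>" for i
      using pos assms by (auto simp: t_def intro!: mult_left_mono power_mono)
  qed (use pos lamI_pos \<theta>\<^sub>c_le void_process_Ob indep_var_obstacles_interferers in auto)
  also have "{1..k} = insert k {1..<k}" using k by auto
  also have "(\<Prod>i\<in>insert k {1..<k}. clear_sector_prob lam\<^sub>o lam\<^sub>I ?\<delta> (t i)) =
      clear_sector_prob lam\<^sub>o lam\<^sub>I ?\<delta> (\<theta>\<^sub>c / 2 * l\<^sup>2) * (\<Prod>i\<in>{1..<k}. clear_sector_prob lam\<^sub>o lam\<^sub>I ?\<delta> 0)"
    by (subst prod.insert) (auto simp: t_def intro!: prod.cong)
  finally show ?thesis by (simp add: mult.commute)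
qed

text \<open>Multiplying by the positive probability of establishment clears the denominator of the
  conditional probability; what remains splits that event by collision.\<close>

lemma one_minus_collision_prob:
  assumes "0 \<le> l"
  shows "exp (- lam\<^sub>o * (\<theta>\<^sub>c / 2 * l\<^sup>2)) * (1 - collision_prob l) =
    prob {\<omega> \<in> space M. established l \<omega> \<and> \<not> collision \<omega>}"
proof -
  have "prob {\<omega> \<in> space M. established l \<omega>} =
      prob ({\<omega> \<in> space M. collision \<omega> \<and> established l \<omega>} \<union> {\<omega> \<in> space M. established l \<omega> \<and> \<not> collision \<omega>})"
    by (intro arg_cong[where f = prob]) auto
  also have "\<dots> = prob {\<omega> \<in> space M. collision \<omega> \<and> established l \<omega>} +
      prob {\<omega> \<in> space M. established l \<omega> \<and> \<not> collision \<omega>}"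
    by (intro finite_measure_Union) auto
  finally have "prob {\<omega> \<in> space M. established l \<omega>} =
      prob {\<omega> \<in> space M. collision \<omega> \<and> established l \<omega>} +
      prob {\<omega> \<in> space M. established l \<omega> \<and> \<not> collision \<omega>}" .
  moreover have "prob {\<omega> \<in> space M. established l \<omega>} \<noteq> 0"
    unfolding prob_established[OF assms] by simp
  then have "prob {\<omega> \<in> space M. established l \<omega>} * collision_prob l =
      prob {\<omega> \<in> space M. collision \<omega> \<and> established l \<omega>}"
    by (simp add: collision_prob_def cond_prob_def)
  ultimately show ?thesis
    unfolding prob_established[OF assms, symmetric] by (simp add: right_diff_distrib)
qed

lemma throughput_eq_integral:
  "throughput = integral {0..d_max} (\<lambda>l. \<rho>\<^sub>a * exp (- lam\<^sub>o * (\<theta>\<^sub>c / 2 * l\<^sup>2)) *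
    (1 - collision_prob l) * (2 * l / d_max\<^sup>2))"
proof -
  let ?E = "\<lambda>l. prob {\<omega> \<in> space M. established l \<omega> \<and> \<not> collision \<omega>}"
  let ?\<delta> = "\<theta>\<^sub>c / 2 * d_max\<^sup>2"
  \<comment> \<open>A closed form of the integrand without \<open>\<rho>\<^sub>a\<close>; its
    continuity on the compact interval provides integrability.\<close>
  define g where "g l = clear_sector_prob lam\<^sub>o lam\<^sub>I ?\<delta> 0 ^ (k - 1) *
    clear_sector_prob lam\<^sub>o lam\<^sub>I ?\<delta> (\<theta>\<^sub>c / 2 * l\<^sup>2) * (2 * l / d_max\<^sup>2)" for l
  have g: "g l = ?E l * (2 * l / d_max\<^sup>2)" if "0 \<le> l" "l \<le> d_max" for l
    using prob_established_no_collision[OF that] by (simp add: g_def)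
  have g_nonneg: "0 \<le> indicator {0..d_max} l * g l" for l
    by (auto simp: indicator_def g)
  have "continuous_on {0..d_max} g"
    unfolding g_def clear_sector_prob_def using pos by (intro continuous_intros) auto
  then have g_int: "set_integrable lborel {0..d_max} g"
    by (rule borel_integrable_compact[OF compact_Icc, folded set_integrable_def[unfolded scaleR_conv_of_real]])
  \<comment> \<open>Both requirements are packed into one real variable: a collision sets it to
    \<open>0\<close>, which exceeds no threshold \<open>\<theta>\<^sub>c / 2 * l\<^sup>2\<close>.
    Since \<open>Z\<close> is measurable in all sources other than the link length,
    \<open>emeasure_indep_distributed\<close> applies.\<close>
  define Z where "Z \<omega> = (if collision \<omega> then 0 else obst k \<omega>)" for \<omega>
  have Z_gt: "\<theta>\<^sub>c / 2 * l\<^sup>2 < Z \<omega> \<longleftrightarrow> \<theta>\<^sub>c / 2 * l\<^sup>2 < obst k \<omega> \<and> \<not> collision \<omega>" for l \<omega>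
    using pos by (auto simp: Z_def not_less)
  have indep: "indep_var borel (\<lambda>\<omega>. cmod (Y \<omega>)) borel Z"
  proof (rule indep_var_source_algebra[of "{Link_Length}" "UNIV - {Link_Length}"])
    have [measurable]: "Measurable.pred (source_algebra (UNIV - {Link_Length})) collision"
      by (rule collision_source) auto
    have [measurable]: "obst k \<in> borel_measurable (source_algebra (UNIV - {Link_Length}))"
      unfolding obst_def[abs_def]
      by (rule nearest_process_measurable) (auto intro: Ob_source)
    show "Z \<in> borel_measurable (source_algebra (UNIV - {Link_Length}))"
      unfolding Z_def[abs_def] by measurable
  qed (auto intro: length_source)
  have [measurable]: "Z \<in> borel_measurable M"
    using indep by (rule indep_var_rv2)
  have [measurable]: "(\<lambda>\<omega>. cmod (Y \<omega>)) \<in> borel_measurable M"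
    using link_position(1) by measurable
  have [measurable]: "Measurable.pred M (\<lambda>\<omega>. established (cmod (Y \<omega>)) \<omega>)"
    by (rule measurable_from_source_algebra[OF established_source[of UNIV]]) (auto intro: length_source)
  have "emeasure M {\<omega> \<in> space M. established (cmod (Y \<omega>)) \<omega> \<and> \<not> collision \<omega>} =
      emeasure M {\<omega> \<in> space M. \<theta>\<^sub>c / 2 * (cmod (Y \<omega>))\<^sup>2 < Z \<omega>}"
    unfolding Z_gt using established_iff_AE by (intro emeasure_eq_AE) auto
  also have "\<dots> = (\<integral>\<^sup>+l. ennreal (if 0 < l \<and> l \<le> d_max then 2 * l / d_max\<^sup>2 else 0) *
      emeasure M {\<omega> \<in> space M. \<theta>\<^sub>c / 2 * l\<^sup>2 < Z \<omega>} \<partial>lborel)"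
    by (rule emeasure_indep_distributed[OF indep link_length]) measurable
  also have "\<dots> = (\<integral>\<^sup>+l. ennreal (indicator {0..d_max} l * g l) \<partial>lborel)"
  proof (rule nn_integral_cong)
    fix l :: real
    show "ennreal (if 0 < l \<and> l \<le> d_max then 2 * l / d_max\<^sup>2 else 0) *
      emeasure M {\<omega> \<in> space M. \<theta>\<^sub>c / 2 * l\<^sup>2 < Z \<omega>} = ennreal (indicator {0..d_max} l * g l)"
    proof (cases "0 < l \<and> l \<le> d_max")
      case True
      have "emeasure M {\<omega> \<in> space M. \<theta>\<^sub>c / 2 * l\<^sup>2 < Z \<omega>} = emeasure M {\<omega> \<in> space M. established l \<omega> \<and> \<not> collision \<omega>}"
        unfolding Z_gt using established_iff_AE True by (intro emeasure_eq_AE) auto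
      then show ?thesis
        using True g[of l] by (simp add: emeasure_eq_measure ennreal_mult'[symmetric] mult.commute)
    next
      case False
      \<comment> \<open>At \<open>l = 0\<close> the indicator of the closed interval does not
        vanish, but the factor \<open>2 * l\<close> in \<open>g\<close> does.\<close>
      then show ?thesis by (cases "l = 0") (auto simp: indicator_def g_def)
    qed
  qed
  also have "\<dots> = ennreal (\<integral>l. indicator {0..d_max} l * g l \<partial>lborel)"
    using g_int g_nonneg by (intro nn_integral_eq_integral) (auto simp: set_integrable_def)
  also have "(\<integral>l. indicator {0..d_max} l * g l \<partial>lborel) = integral {0..d_max} g"
    using set_borel_integral_eq_integral(2)[OF g_int] by (simp add: set_lebesgue_integral_def)
  finally have "ennreal (prob {\<omega> \<in> space M. established (cmod (Y \<omega>)) \<omega> \<and> \<not> collision \<omega>}) =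
      ennreal (integral {0..d_max} g)"
    by (simp add: emeasure_eq_measure)
  moreover have "0 \<le> integral {0..d_max} g"
    using g_nonneg by (intro integral_nonneg set_borel_integral_eq_integral(1)[OF g_int])
      (metis indicator_simps(1) mult_1)
  ultimately have "throughput = \<rho>\<^sub>a * integral {0..d_max} g"
    by (simp add: throughput_eq_prob)
  also have "\<dots> = integral {0..d_max} (\<lambda>l. \<rho>\<^sub>a * g l)"
    by simp
  also have "\<dots> = integral {0..d_max} (\<lambda>l. \<rho>\<^sub>a * exp (- lam\<^sub>o * (\<theta>\<^sub>c / 2 * l\<^sup>2)) *
      (1 - collision_prob l) * (2 * l / d_max\<^sup>2))"
  proof (rule integral_cong)
    fix l assume "l \<in> {0..d_max}"
    then have "0 \<le> l" "l \<le> d_max" by auto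
    then show "\<rho>\<^sub>a * g l = \<rho>\<^sub>a * exp (- lam\<^sub>o * (\<theta>\<^sub>c / 2 * l\<^sup>2)) * (1 - collision_prob l) * (2 * l / d_max\<^sup>2)"
      unfolding g[OF \<open>0 \<le> l\<close> \<open>l \<le> d_max\<close>] one_minus_collision_prob[OF \<open>0 \<le> l\<close>, symmetric] by simp
  qed
  finally show ?thesis .
qed

text \<open>Multiplication by \<open>exp (lam\<^sub>o * s)\<close> divides by the probability of
  establishment. It cancels in the first term of the sector \<open>k\<close> factor and survives in
  the second; the other sectors contribute the value at threshold \<open>0\<close>.\<close>

lemma collision_prob_eq:
  assumes "0 \<le> l" "l \<le> d_max"
  shows "collision_prob l = 1 -
    ((lam\<^sub>o + lam\<^sub>I * exp (- (lam\<^sub>o + lam\<^sub>I) * (\<theta>\<^sub>c / 2 * d_max\<^sup>2))) / (lam\<^sub>o + lam\<^sub>I)) ^ (k - 1) *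
    (exp (- lam\<^sub>I * (\<theta>\<^sub>c / 2 * l\<^sup>2)) - lam\<^sub>I * exp (lam\<^sub>o * (\<theta>\<^sub>c / 2 * l\<^sup>2)) / (lam\<^sub>o + lam\<^sub>I) *
      (exp (- (lam\<^sub>o + lam\<^sub>I) * (\<theta>\<^sub>c / 2 * l\<^sup>2)) - exp (- (lam\<^sub>o + lam\<^sub>I) * (\<theta>\<^sub>c / 2 * d_max\<^sup>2))))"
proof -
  define s where "s = \<theta>\<^sub>c / 2 * l\<^sup>2"
  define \<delta> where "\<delta> = \<theta>\<^sub>c / 2 * d_max\<^sup>2"
  define a where "a = exp (- (lam\<^sub>o + lam\<^sub>I) * \<delta>)"
  have sum: "0 < lam\<^sub>o + lam\<^sub>I" using pos lamI_pos by simp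
  have base: "clear_sector_prob lam\<^sub>o lam\<^sub>I \<delta> 0 = (lam\<^sub>o + lam\<^sub>I * a) / (lam\<^sub>o + lam\<^sub>I)"
    using sum by (simp add: clear_sector_prob_def a_def field_simps)
  have "exp (- lam\<^sub>o * s) * (1 - collision_prob l) =
      ((lam\<^sub>o + lam\<^sub>I * a) / (lam\<^sub>o + lam\<^sub>I)) ^ (k - 1) * clear_sector_prob lam\<^sub>o lam\<^sub>I \<delta> s"
    using one_minus_collision_prob[OF assms(1)] prob_established_no_collision[OF assms] base
    by (simp add: s_def \<delta>_def)
  then have "exp (lam\<^sub>o * s) * (exp (- lam\<^sub>o * s) * (1 - collision_prob l)) =
      ((lam\<^sub>o + lam\<^sub>I * a) / (lam\<^sub>o + lam\<^sub>I)) ^ (k - 1) * (exp (lam\<^sub>o * s) * clear_sector_prob lam\<^sub>o lam\<^sub>I \<delta> s)"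
    by simp
  moreover have "exp (lam\<^sub>o * s) * (exp (- lam\<^sub>o * s) * x) = x" for x
    by (simp add: mult.assoc[symmetric] exp_add[symmetric])
  moreover have "exp (lam\<^sub>o * s) * clear_sector_prob lam\<^sub>o lam\<^sub>I \<delta> s =
      exp (- lam\<^sub>I * s) - lam\<^sub>I * exp (lam\<^sub>o * s) / (lam\<^sub>o + lam\<^sub>I) * (exp (- (lam\<^sub>o + lam\<^sub>I) * s) - a)"
  proof -
    have "exp (lam\<^sub>o * s) * clear_sector_prob lam\<^sub>o lam\<^sub>I \<delta> s =
      exp (lam\<^sub>o * s) * (exp (- lam\<^sub>o * s) * exp (- lam\<^sub>I * s)) -
      exp (lam\<^sub>o * s) * (lam\<^sub>I / (lam\<^sub>o + lam\<^sub>I) * (exp (- (lam\<^sub>o + lam\<^sub>I) * s) - a))"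
      by (simp add: clear_sector_prob_def a_def right_diff_distrib add.commute)
    also have "exp (lam\<^sub>o * s) * (exp (- lam\<^sub>o * s) * exp (- lam\<^sub>I * s)) = exp (- lam\<^sub>I * s)"
      by (simp add: mult.assoc[symmetric] exp_add[symmetric])
    finally show ?thesis by simp
  qed
  ultimately have "1 - collision_prob l = ((lam\<^sub>o + lam\<^sub>I * a) / (lam\<^sub>o + lam\<^sub>I)) ^ (k - 1) *
      (exp (- lam\<^sub>I * s) - lam\<^sub>I * exp (lam\<^sub>o * s) / (lam\<^sub>o + lam\<^sub>I) * (exp (- (lam\<^sub>o + lam\<^sub>I) * s) - a))"
    by (simp only:)
  then show ?thesis
    unfolding s_def[symmetric] \<delta>_def[symmetric] a_def[symmetric] by linarith
qed

end

end

theorem mainTheorem2: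
  fixes M :: "'w measure"
    and lam\<^sub>t lam\<^sub>o lam\<^sub>I \<rho>\<^sub>a \<theta> \<theta>\<^sub>c \<alpha> d_max :: real
    and A \<rho>\<^sub>c :: "real \<Rightarrow> real"
    and T Ob :: "nat \<Rightarrow> 'w \<Rightarrow> complex"
    and act aim :: "nat \<Rightarrow> 'w \<Rightarrow> bool"
    and Y :: "'w \<Rightarrow> complex"
    and act\<^sub>0 :: "'w \<Rightarrow> bool"
  assumes "0 < lam\<^sub>t" and "0 < lam\<^sub>o"
    and "0 < \<rho>\<^sub>a" and "\<rho>\<^sub>a \<le> 1"
    and "0 < d_max"
    and "0 < \<theta>" and "\<theta> \<le> 2 * pi" and "0 < \<theta>\<^sub>c"
    and "\<exists>m::nat. 0 < m \<and> \<theta> / \<theta>\<^sub>c = real m"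
    and "slotted_aloha M lam\<^sub>t lam\<^sub>o \<rho>\<^sub>a \<theta> \<theta>\<^sub>c \<alpha> d_max T act aim Ob Y act\<^sub>0"
    and "lam\<^sub>I = \<rho>\<^sub>a * lam\<^sub>t * \<theta> / (2 * pi)"
    and "\<And>x. 0 \<le> x \<Longrightarrow> A x = \<theta>\<^sub>c * x\<^sup>2 / 2"
    and "\<rho>\<^sub>c = slotted_aloha.collision_prob M \<theta> \<theta>\<^sub>c \<alpha> d_max T act aim Ob"
  shows "slotted_aloha.throughput M \<theta> \<theta>\<^sub>c \<alpha> d_max T act aim Ob Y act\<^sub>0 =
      integral {0..d_max} (\<lambda>l. \<rho>\<^sub>a * exp (- lam\<^sub>o * A l) * (1 - \<rho>\<^sub>c l) * (2 * l / d_max\<^sup>2))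
    \<and> (\<forall>l. 0 < l \<and> l \<le> d_max \<longrightarrow>
        \<rho>\<^sub>c l = 1 -
          ((lam\<^sub>o + lam\<^sub>I * exp (- (lam\<^sub>o + lam\<^sub>I) * A d_max)) / (lam\<^sub>o + lam\<^sub>I))
            ^ (nat \<lceil>\<theta> / \<theta>\<^sub>c\<rceil> - 1) *
          (exp (- lam\<^sub>I * A l) -
            lam\<^sub>I * exp (lam\<^sub>o * A l) / (lam\<^sub>o + lam\<^sub>I) *
              (exp (- (lam\<^sub>o + lam\<^sub>I) * A l) - exp (- (lam\<^sub>o + lam\<^sub>I) * A d_max))))"
proof -
  interpret slotted_aloha M lam\<^sub>t lam\<^sub>o \<rho>\<^sub>a \<theta> \<theta>\<^sub>c \<alpha> d_max T act aim Ob Y act\<^sub>0 by fact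
  obtain k :: nat where k: "0 < k" "\<theta> / \<theta>\<^sub>c = real k" using assms(9) by blast
  have A: "A x = \<theta>\<^sub>c / 2 * x\<^sup>2" if "0 \<le> x" for x
    using assms(12)[OF that] by simp
  have k_eq: "nat \<lceil>\<theta> / \<theta>\<^sub>c\<rceil> = k" by (simp add: k)
  note params = assms(1-3) assms(5-8) k assms(11)
  show ?thesis
  proof (intro conjI allI impI)
    show "throughput = integral {0..d_max} (\<lambda>l. \<rho>\<^sub>a * exp (- lam\<^sub>o * A l) * (1 - \<rho>\<^sub>c l) * (2 * l / d_max\<^sup>2))"
      unfolding throughput_eq_integral[OF params] assms(13)
      by (rule integral_cong) (simp add: A)
    fix l assume "0 < l \<and> l \<le> d_max"
    then show "\<rho>\<^sub>c l = 1 -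
          ((lam\<^sub>o + lam\<^sub>I * exp (- (lam\<^sub>o + lam\<^sub>I) * A d_max)) / (lam\<^sub>o + lam\<^sub>I))
            ^ (nat \<lceil>\<theta> / \<theta>\<^sub>c\<rceil> - 1) *
          (exp (- lam\<^sub>I * A l) -
            lam\<^sub>I * exp (lam\<^sub>o * A l) / (lam\<^sub>o + lam\<^sub>I) *
              (exp (- (lam\<^sub>o + lam\<^sub>I) * A l) - exp (- (lam\<^sub>o + lam\<^sub>I) * A d_max)))"
      using assms(5) unfolding k_eq assms(13) by (simp only: A less_imp_le collision_prob_eq[OF params])
  qed
qed

end
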